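(* Let $(\sigma,\alpha)$ be a hypermap with short hyperedges and let $G(\sigma,\alpha)$ be its associated two-colored graph, with set of vertices $V(\sigma,\alpha)$ and set of white vertices $W(\sigma,\alpha)$. Then the number of spanning hypertrees of $(\sigma,\alpha)$ is $$\sum_{S\subseteq W(\sigma,\alpha)}(-2)^{|S|}\,s\left(G(\sigma,\alpha)|_{V(\sigma,\alpha)-S}\right),$$ where $s(G)$ denotes the number of spanning trees of a graph $G$.
   Context: A hypermap is a pair $(\sigma,\alpha)$ of permutations of $\{1,\ldots,n\}$ generating a transitive group. The cycles of $\sigma$ are the vertices, the cycles of $\alpha$ the hyperedges, the cycles of $\alpha^{-1}\sigma$ the faces. $z(\pi)$ is the number of cycles of $\pi$, fixed points included. The genus $g(\sigma,\alpha)$ of a hypermap is defined by $n+2-2g(\sigma,\alpha)=z(\sigma)+z(\alpha)+z(\alpha^{-1}\sigma)$. A hypermap has short hyperedges if every cycle of $\alpha$ has at most three points. A permutation $\theta$ is a refinement of $\alpha$ if for each cycle $\gamma$ of $\alpha$, $\theta$ maps the set of points of $\gamma$ to itself and the restriction $\theta_\gamma$ of $\theta$ to this set satisfies $g(\theta_\gamma,\gamma)=0$. For short hyperedges: $(i,j)$ has refinements $(i,j)$ and $(i)(j)$, and $(i,j,k)$ has refinements $(i,j,k)$, $(i,j)(k)$, $(i,k)(j)$, $(j,k)(i)$, $(i)(j)(k)$. A spanning hypertree of $(\sigma,\alpha)$ is a hypermap $(\sigma,\theta)$ with $\theta$ a refinement of $\alpha$ that has genus zero and is unicellular, i.e. $z(\theta^{-1}\sigma)=1$.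 The associated two-colored map $(\mathbf S_\alpha(\sigma),\mathbf A_\alpha(\alpha))$: every cycle of $\sigma$ is kept as a cycle of $\mathbf S_\alpha(\sigma)$ (black vertex); every $2$-cycle of $\alpha$ (and every fixed point of $\alpha$) is kept as a cycle of $\mathbf A_\alpha(\alpha)$; for each $3$-cycle $(i,j,k)$ of $\alpha$, new (white) points $i',j',k'$ are added, $(i',k',j')$ is added as a cycle of $\mathbf S_\alpha(\sigma)$ (white vertex), and $(i,i'),(j,j'),(k,k')$ are cycles of $\mathbf A_\alpha(\alpha)$. The associated two-colored graph $G(\sigma,\alpha)$ is the underlying multigraph (loops and parallel edges allowed): its vertices are the cycles of $\mathbf S_\alpha(\sigma)$ and its edges the $2$-cycles of $\mathbf A_\alpha(\alpha)$, each joining the vertices containing its two points. For a set $X$ of vertices, $G|_X$ is the graph with vertex set $X$ whose edges are those edges of $G$ with both endpoints in $X$. Spanning trees are counted as edge sets, so parallel edges are distinguished; $s(G)=0$ if $G$ is disconnected. *)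

theory Defs
  imports Complex_Main "HOL-Algebra.Sym_Groups" "HOL-Combinatorics.Orbits"
begin

section \<open>Hypermaps\<close>

text \<open>A cycle is identified with its set of points; fixed points give singleton cycles.
  For a bijection of a finite set, \<open>Orbits.orbit p x\<close> is the cycle of \<open>p\<close> through \<open>x\<close>.\<close>

definition perm_cycles :: "('a \<Rightarrow> 'a) \<Rightarrow> 'a set \<Rightarrow> 'a set set" where
  "perm_cycles p A = Orbits.orbit p ` A"

definition num_cycles :: "('a \<Rightarrow> 'a) \<Rightarrow> 'a set \<Rightarrow> nat" where
  "num_cycles p A = card (perm_cycles p A)"

definition hypermap :: "nat \<Rightarrow> (nat \<Rightarrow> nat) \<Rightarrow> (nat \<Rightarrow> nat) \<Rightarrow> bool" where
  "hypermap n \<sigma> \<alpha> \<longleftrightarrow>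
     \<sigma> permutes {1..n} \<and> \<alpha> permutes {1..n} \<and>
     (\<forall>i\<in>{1..n}. \<forall>j\<in>{1..n}. \<exists>p\<in>generate (sym_group n) {\<sigma>, \<alpha>}. p i = j)"

text \<open>The genus is taken relative to an explicit finite set \<open>A\<close> of points, because the definition
  of refinements needs it on the points of a single cycle.
  It is the solution \<open>g\<close> of \<open>|A| + 2 - 2g = z(\<sigma>) + z(\<alpha>) + z(\<alpha>\<^sup>-\<^sup>1\<sigma>)\<close>, rational-valued so
  that no rounding takes place. The notation \<open>inv'\<close> is the functional inverse. Composing the
  other way round gives a conjugate of \<open>\<alpha>\<^sup>-\<^sup>1\<sigma>\<close>, hence the same number of cycles.\<close>

definition genus :: "'a set \<Rightarrow> ('a \<Rightarrow> 'a) \<Rightarrow> ('a \<Rightarrow> 'a) \<Rightarrow> rat" where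
  "genus A \<sigma> \<alpha> =
     (of_nat (card A) + 2
       - of_nat (num_cycles \<sigma> A + num_cycles \<alpha> A + num_cycles (inv' \<alpha> \<circ> \<sigma>) A)) / 2"

definition short_hyperedges :: "nat \<Rightarrow> (nat \<Rightarrow> nat) \<Rightarrow> bool" where
  "short_hyperedges n \<alpha> \<longleftrightarrow> (\<forall>c\<in>perm_cycles \<alpha> {1..n}. card c \<le> 3)"

text \<open>The pair of restrictions to a cycle of \<open>\<alpha>\<close> is automatically transitive on its points.\<close>

definition refinement :: "nat \<Rightarrow> (nat \<Rightarrow> nat) \<Rightarrow> (nat \<Rightarrow> nat) \<Rightarrow> bool" where
  "refinement n \<alpha> \<theta> \<longleftrightarrow>
     \<theta> permutes {1..n} \<and>
     (\<forall>c\<in>perm_cycles \<alpha> {1..n}.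
        \<theta> ` c = c \<and> genus c (perm_restrict \<theta> c) (perm_restrict \<alpha> c) = 0)"

definition unicellular :: "nat \<Rightarrow> (nat \<Rightarrow> nat) \<Rightarrow> (nat \<Rightarrow> nat) \<Rightarrow> bool" where
  "unicellular n \<sigma> \<theta> \<longleftrightarrow> num_cycles (inv' \<theta> \<circ> \<sigma>) {1..n} = 1"

definition spanning_hypertree ::
    "nat \<Rightarrow> (nat \<Rightarrow> nat) \<Rightarrow> (nat \<Rightarrow> nat) \<Rightarrow> (nat \<Rightarrow> nat) \<Rightarrow> bool" where
  "spanning_hypertree n \<sigma> \<alpha> \<theta> \<longleftrightarrow>
     hypermap n \<sigma> \<theta> \<and> refinement n \<alpha> \<theta> \<and> genus {1..n} \<sigma> \<theta> = 0 \<and> unicellular n \<sigma> \<theta>"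


section \<open>Undirected multigraphs and spanning trees\<close>

text \<open>The set \<open>ends G e\<close> of endpoints has one element if \<open>e\<close> is a loop and two otherwise.\<close>

record ('v, 'e) multigraph =
  verts :: "'v set"
  edges :: "'e set"
  ends :: "'e \<Rightarrow> 'v set"

definition induced :: "('v, 'e) multigraph \<Rightarrow> 'v set \<Rightarrow> ('v, 'e) multigraph" where
  "induced G X = \<lparr>verts = X, edges = {e \<in> edges G. ends G e \<subseteq> X}, ends = ends G\<rparr>"

definition adjacency :: "('v, 'e) multigraph \<Rightarrow> ('v \<times> 'v) set" where
  "adjacency G = {(u, v). \<exists>e\<in>edges G. ends G e = {u, v}}"

text \<open>The graph without vertices does not count as connected.\<close>

definition mg_connected :: "('v, 'e) multigraph \<Rightarrow> bool" where
  "mg_connected G \<longleftrightarrow>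
     verts G \<noteq> {} \<and> (\<forall>u\<in>verts G. \<forall>v\<in>verts G. (u, v) \<in> (adjacency G)\<^sup>*)"

text \<open>A cycle of length 1 is a loop, and one of length 2 is a pair of parallel edges.\<close>

definition mg_cycle :: "('v, 'e) multigraph \<Rightarrow> 'v list \<Rightarrow> 'e list \<Rightarrow> bool" where
  "mg_cycle G vs es \<longleftrightarrow>
     es \<noteq> [] \<and> length vs = length es \<and> distinct vs \<and> distinct es \<and>
     set vs \<subseteq> verts G \<and> set es \<subseteq> edges G \<and>
     (\<forall>i<length es. ends G (es ! i) = {vs ! i, vs ! (Suc i mod length vs)})"

definition mg_tree :: "('v, 'e) multigraph \<Rightarrow> bool" where
  "mg_tree G \<longleftrightarrow> mg_connected G \<and> (\<nexists>vs es. mg_cycle G vs es)"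

definition num_spanning_trees :: "('v, 'e) multigraph \<Rightarrow> nat" where
  "num_spanning_trees G = card {T. T \<subseteq> edges G \<and> mg_tree (G\<lparr>edges := T\<rparr>)}"


section \<open>The associated two-colored map and graph\<close>

text \<open>\<open>Inl i\<close> is the original point \<open>i\<close>, and \<open>Inr i\<close> is the new white point \<open>i'\<close>, which exists
  only for \<open>i\<close> on a 3-cycle of \<open>\<alpha>\<close>.\<close>

definition three_points :: "nat \<Rightarrow> (nat \<Rightarrow> nat) \<Rightarrow> nat set" where
  "three_points n \<alpha> = {i \<in> {1..n}. card (Orbits.orbit \<alpha> i) = 3}"

definition tc_points :: "nat \<Rightarrow> (nat \<Rightarrow> nat) \<Rightarrow> (nat + nat) set" where
  "tc_points n \<alpha> = Inl ` {1..n} \<union> Inr ` three_points n \<alpha>"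

text \<open>The white cycle \<open>(i',k',j')\<close> for a 3-cycle \<open>(i,j,k)\<close> of \<open>\<alpha>\<close> amounts to following \<open>\<alpha>\<close>
  backwards on primed points.\<close>

definition tc_S ::
    "nat \<Rightarrow> (nat \<Rightarrow> nat) \<Rightarrow> (nat \<Rightarrow> nat) \<Rightarrow> nat + nat \<Rightarrow> nat + nat" where
  "tc_S n \<sigma> \<alpha> x =
     (case x of
        Inl i \<Rightarrow> Inl (\<sigma> i)
      | Inr i \<Rightarrow> if i \<in> three_points n \<alpha> then Inr (inv' \<alpha> i) else Inr i)"

definition tc_A :: "nat \<Rightarrow> (nat \<Rightarrow> nat) \<Rightarrow> nat + nat \<Rightarrow> nat + nat" where
  "tc_A n \<alpha> x =
     (case x of
        Inl i \<Rightarrow> if i \<in> three_points n \<alpha> then Inr i else Inl (\<alpha> i)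
      | Inr i \<Rightarrow> if i \<in> three_points n \<alpha> then Inl i else Inr i)"

definition tc_graph ::
    "nat \<Rightarrow> (nat \<Rightarrow> nat) \<Rightarrow> (nat \<Rightarrow> nat) \<Rightarrow> ((nat + nat) set, (nat + nat) set) multigraph" where
  "tc_graph n \<sigma> \<alpha> =
     \<lparr>verts = perm_cycles (tc_S n \<sigma> \<alpha>) (tc_points n \<alpha>),
      edges = {c \<in> perm_cycles (tc_A n \<alpha>) (tc_points n \<alpha>). card c = 2},
      ends = (\<lambda>c. Orbits.orbit (tc_S n \<sigma> \<alpha>) ` c)\<rparr>"

definition white_verts :: "nat \<Rightarrow> (nat \<Rightarrow> nat) \<Rightarrow> (nat \<Rightarrow> nat) \<Rightarrow> (nat + nat) set set" where
  "white_verts n \<sigma> \<alpha> = perm_cycles (tc_S n \<sigma> \<alpha>) (Inr ` three_points n \<alpha>)"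

end

theory Submission
  imports Defs
begin

text \<open>Record a set of edges of the two-colored graph by the set \<open>Q\<close> of black points that it
  uses, and delete the white vertices that it misses. What remains is a spanning tree iff
  \<open>\<sigma>\<close> together with the pairs in \<open>Q\<close> on a common cycle of \<open>\<alpha>\<close> connects all points, and
  \<open>|Q| + 1\<close> is the number of cycles of \<open>\<sigma>\<close> plus the number of cycles of \<open>\<alpha>\<close> that meet \<open>Q\<close>.
  This condition ignores the points of \<open>Q\<close> that are alone on their cycle of \<open>\<alpha>\<close>, which
  correspond to white leaves. On a 3-cycle, choosing no point has weight \<open>-2\<close> and choosing a
  single one of the three points has weight 1, so these choices together count once, and only
  the sets \<open>Q\<close> without lonely points are counted. They are the supports of the refinements
  \<open>\<theta>\<close> of \<open>\<alpha>\<close>, and the condition says that \<open>(\<sigma>, \<theta>)\<close> is transitive with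
  \<open>z(\<sigma>) + z(\<theta>) = n + 1\<close>. Since the genus is nonnegative, such a hypermap is unicellular.\<close>

section \<open>Components of a relation\<close>

text \<open>Short hyperedges make a refinement recoverable from the points it moves: of the six
  permutations of a 3-cycle only the inverse cycle has positive genus, and the other five have
  distinct supports, of sizes 0, 2 and 3. A permutation never moves exactly one point, whereas a
  tree may well use a single spoke at a white vertex. The alternating sum repairs this mismatch:
  being trivial on a 3-cycle corresponds to three trees with a white leaf there and to one tree with
  the vertex deleted, so the deletion has to carry the coefficient \<open>1 - 3 = -2\<close>. The
  obstacle is that the two sides speak of different objects, permutations with faces and multigraphs
  whose vertices are sets. Both are reduced to one condition on sets of points,
  \<open>tree_set\<close>, made of a component count and a cardinality. Faces disappear through the
  genus inequality, and graph cycles through the description of trees by their number of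
  edges.\<close>

definition conn :: "('a \<times> 'a) set \<Rightarrow> ('a \<times> 'a) set" where
  "conn r = (r \<union> r\<inverse>)\<^sup>*"

text \<open>The classes are formed on the whole type and those meeting \<open>A\<close> are counted.
  Graphs of permutations of \<open>A\<close> thus need no restriction, since they only add loops
  outside \<open>A\<close>.\<close>

definition comps :: "'a set \<Rightarrow> ('a \<times> 'a) set \<Rightarrow> nat" where
  "comps A r = card ((\<lambda>x. conn r `` {x}) ` A)"

lemma conn_refl [simp]: "(x, x) \<in> conn r"
  by (simp add: conn_def)

lemma conn_sym: "(x, y) \<in> conn r \<Longrightarrow> (y, x) \<in> conn r"
  unfolding conn_def by (metis converse_Un converse_converse rtrancl_converseI sup_commute)

lemma conn_trans: "(x, y) \<in> conn r \<Longrightarrow> (y, z) \<in> conn r \<Longrightarrow> (x, z) \<in> conn r"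
  unfolding conn_def by (rule rtrancl_trans)

lemma conn_incl: "(x, y) \<in> r \<Longrightarrow> (x, y) \<in> conn r"
  by (auto simp: conn_def)

lemma conn_induct [consumes 1, case_names refl step]:
  assumes "(x, y) \<in> conn r" and "P x"
    and "\<And>y z. (x, y) \<in> conn r \<Longrightarrow> (y, z) \<in> r \<or> (z, y) \<in> r \<Longrightarrow> P y \<Longrightarrow> P z"
  shows "P y"
  using assms(1) unfolding conn_def
proof (induction rule: rtrancl_induct)
  case (step y z)
  then show ?case using assms(3)[of y z] by (auto simp: conn_def)
qed (rule assms(2))

lemma conn_least:
  assumes "r \<subseteq> conn s" shows "conn r \<subseteq> conn s"
proof -
  have "r \<union> r\<inverse> \<subseteq> (s \<union> s\<inverse>)\<^sup>*"
    using assms by (auto simp: conn_def[symmetric] intro: conn_sym)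
  then show ?thesis unfolding conn_def using rtrancl_subset_rtrancl by blast
qed

lemma conn_eqI: "r \<subseteq> conn s \<Longrightarrow> s \<subseteq> conn r \<Longrightarrow> conn r = conn s"
  by (simp add: conn_least subset_antisym)

lemma conn_mono: "r \<subseteq> s \<Longrightarrow> conn r \<subseteq> conn s"
  by (meson conn_incl conn_least subrelI subsetD)

lemma class_eq_iff: "conn r `` {x} = conn r `` {y} \<longleftrightarrow> (x, y) \<in> conn r"
proof
  assume "conn r `` {x} = conn r `` {y}"
  moreover have "y \<in> conn r `` {y}" by simp
  ultimately have "y \<in> conn r `` {x}" by (simp only:)
  then show "(x, y) \<in> conn r" by simp
next
  assume "(x, y) \<in> conn r"
  then show "conn r `` {x} = conn r `` {y}"
    using conn_sym[of x y r] conn_trans[of x y r] conn_trans[of y x r] by blast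
qed

text \<open>A path that uses the new pair several times can be shortened to one that uses it at most
  once, in one of the two directions.\<close>

lemma conn_insert_iff:
  "(x, y) \<in> conn (insert (a, b) r) \<longleftrightarrow>
     (x, y) \<in> conn r \<or> (x, a) \<in> conn r \<and> (b, y) \<in> conn r \<or> (x, b) \<in> conn r \<and> (a, y) \<in> conn r"
  (is "?L \<longleftrightarrow> ?R y")
proof
  assume ?L then show "?R y"
  proof (induction rule: conn_induct)
    case (step y z)
    then consider "(y, z) \<in> conn r" | "y = a" "z = b" | "y = b" "z = a"
      by (auto intro: conn_incl conn_sym)
    then show ?case
    proof cases
      case 1
      then show ?thesis using step.IH by (meson conn_trans)
    qed (use step.IH in \<open>meson conn_refl conn_sym\<close>)+
  qed simp
next
  have *: "conn r \<subseteq> conn (insert (a, b) r)" by (rule conn_mono) auto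
  moreover have "(a, b) \<in> conn (insert (a, b) r)" by (rule conn_incl) simp
  moreover assume "?R y"
  ultimately show ?L by (meson conn_sym conn_trans subsetD)
qed

lemma conn_insert_same: "(a, b) \<in> conn r \<Longrightarrow> conn (insert (a, b) r) = conn r"
  by (rule conn_eqI) (auto intro: conn_incl)

lemma comps_cong: "conn r = conn s \<Longrightarrow> comps A r = comps A s"
  by (simp add: comps_def)

lemma comps_insert_diff:
  assumes "finite A" "a \<in> A" "b \<in> A" "(a, b) \<notin> conn r"
  shows "Suc (comps A (insert (a, b) r)) = comps A r"
proof -
  let ?c = "\<lambda>x. conn r `` {x}" and ?d = "\<lambda>x. conn (insert (a, b) r) `` {x}"
  have d: "?d x = (if (x, a) \<in> conn r \<or> (x, b) \<in> conn r then ?c a \<union> ?c b else ?c x)" for x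
  proof (cases "(x, a) \<in> conn r \<or> (x, b) \<in> conn r")
    case True
    then have "(x, y) \<in> conn (insert (a, b) r) \<longleftrightarrow> (a, y) \<in> conn r \<or> (b, y) \<in> conn r" for y
      unfolding conn_insert_iff by (meson conn_sym conn_trans)
    then show ?thesis using True by auto
  next
    case False
    then show ?thesis by (auto simp: conn_insert_iff)
  qed
  have mem: "?c x = ?c a \<or> ?c x = ?c b \<longleftrightarrow> (x, a) \<in> conn r \<or> (x, b) \<in> conn r" for x
    by (simp add: class_eq_iff)
  have "?d ` A = insert (?c a \<union> ?c b) (?c ` A - {?c a, ?c b})"
  proof (intro subset_antisym subsetI)
    fix X assume "X \<in> ?d ` A"
    then obtain x where "x \<in> A" "X = ?d x" by blast
    then show "X \<in> insert (?c a \<union> ?c b) (?c ` A - {?c a, ?c b})"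
      using d[of x] mem[of x] by (auto split: if_splits)
  next
    fix X assume X: "X \<in> insert (?c a \<union> ?c b) (?c ` A - {?c a, ?c b})"
    show "X \<in> ?d ` A"
    proof (cases "X = ?c a \<union> ?c b")
      case True then show ?thesis using assms(2) d[of a] by auto
    next
      case False
      then obtain x where "x \<in> A" "X = ?c x" "X \<noteq> ?c a" "X \<noteq> ?c b" using X by auto
      then show ?thesis using d[of x] mem[of x] by auto
    qed
  qed
  \<comment> \<open>The merged class must be new, as otherwise inserting it would not raise the
    cardinality.\<close>
  moreover have "?c a \<union> ?c b \<notin> ?c ` A"
  proof
    assume "?c a \<union> ?c b \<in> ?c ` A"
    then obtain x where "?c a \<union> ?c b = ?c x" by auto
    moreover have "a \<in> ?c a" "b \<in> ?c b" by simp_all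
    ultimately have "a \<in> ?c x" "b \<in> ?c x" by (metis UnCI)+
    then have "(x, a) \<in> conn r" "(x, b) \<in> conn r" by simp_all
    then show False using assms(4) by (meson conn_sym conn_trans)
  qed
  ultimately have "comps A (insert (a, b) r) = Suc (card (?c ` A - {?c a, ?c b}))"
    using assms(1) by (simp add: comps_def)
  also have "card (?c ` A - {?c a, ?c b}) = comps A r - 2"
    using assms by (subst card_Diff_subset) (auto simp: comps_def class_eq_iff)
  finally show ?thesis
  proof -
    \<comment> \<open>At least two classes exist, so the natural-number difference
      \<open>comps A r - 2\<close> is not truncated.\<close>
    have "card {?c a, ?c b} \<le> comps A r"
      unfolding comps_def using assms by (intro card_mono) auto
    moreover have "card {?c a, ?c b} = 2" using assms(4) by (simp add: class_eq_iff)
    ultimately show ?thesis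
      using \<open>comps A (insert (a, b) r) = Suc (card (?c ` A - {?c a, ?c b}))\<close>
        \<open>card (?c ` A - {?c a, ?c b}) = comps A r - 2\<close> by linarith
  qed
qed

lemma comps_insert_same:
  "(a, b) \<in> conn r \<Longrightarrow> comps A (insert (a, b) r) = comps A r"
  by (simp add: comps_def conn_insert_same)

lemma comps_insert_bounds:
  assumes "finite A" "a \<in> A" "b \<in> A"
  shows "comps A (insert (a, b) r) \<le> comps A r" "comps A r \<le> Suc (comps A (insert (a, b) r))"
  using comps_insert_diff[OF assms, of r] comps_insert_same[of a b r A]
  by (cases "(a, b) \<in> conn r"; simp)+

lemma conn_empty: "conn {} = Id"
  by (simp add: conn_def)

lemma comps_empty: "comps A {} = card A"
  unfolding comps_def conn_empty by (simp add: card_image inj_on_def)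

lemma comps_1_iff:
  "comps A r = 1 \<longleftrightarrow> A \<noteq> {} \<and> (\<forall>x\<in>A. \<forall>y\<in>A. (x, y) \<in> conn r)"
proof
  assume "comps A r = 1"
  then obtain X where "(\<lambda>x. conn r `` {x}) ` A = {X}"
    unfolding comps_def by (auto simp: card_1_singleton_iff)
  then show "A \<noteq> {} \<and> (\<forall>x\<in>A. \<forall>y\<in>A. (x, y) \<in> conn r)"
    by (metis (no_types, lifting) class_eq_iff image_eqI image_is_empty insert_not_empty singletonD)
next
  assume *: "A \<noteq> {} \<and> (\<forall>x\<in>A. \<forall>y\<in>A. (x, y) \<in> conn r)"
  then obtain a where "a \<in> A" by blast
  then have "(\<lambda>x. conn r `` {x}) ` A = {conn r `` {a}}"
    using * class_eq_iff[of r a] by auto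
  then show "comps A r = 1" by (simp add: comps_def)
qed

section \<open>Trees\<close>

lemma adjacency_sym: "(adjacency G)\<inverse> = adjacency G"
  by (auto simp: adjacency_def insert_commute)

lemma mg_connected_iff: "mg_connected G \<longleftrightarrow> comps (verts G) (adjacency G) = 1"
  unfolding mg_connected_def comps_1_iff conn_def adjacency_sym by simp

lemma conn_adjacency_insert:
  assumes "ends G e = {u, v}"
  shows "conn (adjacency (G\<lparr>edges := insert e E\<rparr>)) = conn (insert (u, v) (adjacency (G\<lparr>edges := E\<rparr>)))"
  by (rule conn_eqI)
    (auto simp: adjacency_def assms doubleton_eq_iff intro: conn_incl conn_sym)

lemma comps_adjacency_insert:
  assumes "ends G e = {u, v}"
  shows "comps V (adjacency (G\<lparr>edges := insert e E\<rparr>)) = comps V (insert (u, v) (adjacency (G\<lparr>edges := E\<rparr>)))"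
  using conn_adjacency_insert[OF assms] by (simp add: comps_def)

text \<open>Without edges every vertex is a component, and each added edge merges at most two
  components.\<close>

lemma card_le_comps:
  assumes "finite V" "finite E" "\<forall>e\<in>E. \<exists>u\<in>V. \<exists>v\<in>V. ends G e = {u, v}"
  shows "card V \<le> comps V (adjacency (G\<lparr>edges := E\<rparr>)) + card E"
  using assms(2,3)
proof (induction E)
  case empty
  then show ?case by (simp add: adjacency_def comps_empty)
next
  case (insert e E)
  then obtain u v where "u \<in> V" "v \<in> V" "ends G e = {u, v}" by blast
  then show ?case
    using insert comps_insert_bounds(2)[OF assms(1), of u v "adjacency (G\<lparr>edges := E\<rparr>)"]
    by (simp add: comps_adjacency_insert)
qed

text \<open>Induction along a walk. When the next vertex already lies on the path, the path is cut
  back to that vertex instead of being extended, which keeps the vertices distinct.\<close>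

lemma adjacency_simple_path:
  assumes "(u, v) \<in> (adjacency G)\<^sup>*" "u \<in> verts G" "\<forall>e\<in>edges G. ends G e \<subseteq> verts G"
  obtains vs es where "vs \<noteq> []" "hd vs = u" "last vs = v" "distinct vs" "set vs \<subseteq> verts G"
    "length vs = Suc (length es)" "set es \<subseteq> edges G"
    "\<forall>i<length es. ends G (es ! i) = {vs ! i, vs ! Suc i}"
proof -
  have "\<exists>vs es. vs \<noteq> [] \<and> hd vs = u \<and> last vs = v \<and> distinct vs \<and> set vs \<subseteq> verts G \<and>
    length vs = Suc (length es) \<and> set es \<subseteq> edges G \<and>
    (\<forall>i<length es. ends G (es ! i) = {vs ! i, vs ! Suc i})"
    using assms(1)
  proof (induction rule: rtrancl_induct)
    case base
    show ?case using assms(2) by (intro exI[of _ "[u]"] exI[of _ "[]"]) simp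
  next
    case (step v w)
    then obtain vs es where P: "vs \<noteq> []" "hd vs = u" "last vs = v" "distinct vs"
      "set vs \<subseteq> verts G" "length vs = Suc (length es)" "set es \<subseteq> edges G"
      "\<forall>i<length es. ends G (es ! i) = {vs ! i, vs ! Suc i}" by blast
    from step(2) obtain e where e: "e \<in> edges G" "ends G e = {v, w}"
      by (auto simp: adjacency_def)
    show ?case
    proof (cases "w \<in> set vs")
      case True
      then obtain k where k: "k < length vs" "vs ! k = w" by (auto simp: in_set_conv_nth)
      have "last (take (Suc k) vs) = w" using k by (simp add: take_Suc_conv_app_nth)
      then show ?thesis using P k
        by (intro exI[of _ "take (Suc k) vs"] exI[of _ "take k es"])
          (auto dest: in_set_takeD)
    next
      case False
      have last: "vs ! length es = v" using P(1,3,6) by (simp add: last_conv_nth)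
      show ?thesis using P e False assms(3) last
        by (intro exI[of _ "vs @ [w]"] exI[of _ "es @ [e]"])
          (auto simp: nth_append less_Suc_eq)
    qed
  qed
  then show ?thesis using that by blast
qed

text \<open>The new edge closes a simple path from \<open>u\<close> to \<open>v\<close>. For
  \<open>u = v\<close> the path is a single vertex and the cycle is a loop.\<close>

lemma mg_cycle_insert_connected:
  assumes "(u, v) \<in> conn (adjacency (G\<lparr>edges := E\<rparr>))" "u \<in> verts G"
    "\<forall>e\<in>E. ends G e \<subseteq> verts G" "ends G e = {u, v}" "e \<notin> E"
  shows "\<exists>vs es. mg_cycle (G\<lparr>edges := insert e E\<rparr>) vs es"
proof -
  have "(u, v) \<in> (adjacency (G\<lparr>edges := E\<rparr>))\<^sup>*"
    using assms(1) by (simp add: conn_def adjacency_sym)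
  then obtain vs es where P: "vs \<noteq> []" "hd vs = u" "last vs = v" "distinct vs"
      "set vs \<subseteq> verts G" "length vs = Suc (length es)" "set es \<subseteq> E"
      "\<forall>i<length es. ends G (es ! i) = {vs ! i, vs ! Suc i}"
    using assms(2,3) adjacency_simple_path[of u v "G\<lparr>edges := E\<rparr>"]
    by (simp add: subset_iff) metis
  \<comment> \<open>Edges at different positions of the path have different endpoint sets, because
    the vertices are distinct.\<close>
  have "distinct es"
  proof (subst distinct_conv_nth, intro allI impI notI)
    fix i j assume ij: "i < length es" "j < length es" "i \<noteq> j" "es ! i = es ! j"
    then have "{vs ! i, vs ! Suc i} = {vs ! j, vs ! Suc j}" using P(8) by metis
    then show False using ij P(4,6) by (auto simp: doubleton_eq_iff nth_eq_iff_index_eq)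
  qed
  \<comment> \<open>Only the closing edge wraps around; the modulus is the number of edges including
    \<open>e\<close>.\<close>
  moreover have M: "Suc i mod Suc (length es) = Suc i" if "i < length es" for i
    using that by (intro mod_less) simp
  moreover have "vs ! length es = v" "vs ! 0 = u"
    using P(1,2,3,6) by (simp_all add: last_conv_nth hd_conv_nth)
  ultimately have "mg_cycle (G\<lparr>edges := insert e E\<rparr>) vs (es @ [e])"
    using P assms(4,5) M by (auto simp: mg_cycle_def nth_append less_Suc_eq insert_commute)
  then show ?thesis by blast
qed

text \<open>Without cycles every added edge joins two different components, so the inequality of
  \<open>card_le_comps\<close> loses nothing.\<close>

lemma acyclic_card_eq:
  assumes "finite (verts G)" "finite E" "\<forall>e\<in>E. \<exists>u\<in>verts G. \<exists>v\<in>verts G. ends G e = {u, v}"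
    and "\<nexists>vs es. mg_cycle (G\<lparr>edges := E\<rparr>) vs es"
  shows "card (verts G) = comps (verts G) (adjacency (G\<lparr>edges := E\<rparr>)) + card E"
  using assms(2,3,4)
proof (induction E)
  case empty
  then show ?case by (simp add: adjacency_def comps_empty)
next
  case (insert e E)
  then obtain u v where uv: "u \<in> verts G" "v \<in> verts G" "ends G e = {u, v}" by blast
  have "mg_cycle (G\<lparr>edges := E\<rparr>) vs es \<Longrightarrow> mg_cycle (G\<lparr>edges := insert e E\<rparr>) vs es" for vs es
    by (auto simp: mg_cycle_def)
  then have IH: "card (verts G) = comps (verts G) (adjacency (G\<lparr>edges := E\<rparr>)) + card E"
    using insert by blast
  have "\<forall>e\<in>E. ends G e \<subseteq> verts G" using insert.prems(1) by fastforce
  then have "(u, v) \<notin> conn (adjacency (G\<lparr>edges := E\<rparr>))"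
    using mg_cycle_insert_connected[of u v E G e] uv insert.prems(2) insert.hyps(2) by argo
  then show ?case
    using comps_insert_diff[OF assms(1) uv(1,2)] IH insert.hyps
    by (simp add: comps_adjacency_insert[where E=E, OF uv(3)])
qed

text \<open>Removing one edge of a cycle leaves the components unchanged, so the bound of
  \<open>card_le_comps\<close> already holds with one edge fewer.\<close>

lemma mg_cycle_card_less:
  assumes "finite (verts G)" "finite (edges G)"
    "\<forall>e\<in>edges G. \<exists>u\<in>verts G. \<exists>v\<in>verts G. ends G e = {u, v}" and "mg_cycle G vs es"
  shows "card (verts G) < comps (verts G) (adjacency G) + card (edges G)"
proof -
  \<comment> \<open>The removed edge is the closing one, between the last vertex and
    \<open>vs ! 0\<close>; the others still lead from \<open>vs ! 0\<close> to
    \<open>vs ! m\<close>.\<close>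
  define m where "m = length es - 1"
  define e where "e = es ! m"
  define E where "E = edges G - {e}"
  let ?A = "adjacency (G\<lparr>edges := E\<rparr>)"
  have C: "es \<noteq> []" "length vs = length es" "distinct es" "set es \<subseteq> edges G"
    "\<forall>i<length es. ends G (es ! i) = {vs ! i, vs ! (Suc i mod length vs)}"
    using assms(4) by (auto simp: mg_cycle_def)
  have m: "m < length es" "length es = Suc m" using C(1) by (auto simp: m_def)
  have e: "e \<in> edges G" "ends G e = {vs ! m, vs ! 0}"
    using C m by (auto simp: e_def)
  have "i \<le> m \<Longrightarrow> (vs ! 0, vs ! i) \<in> conn ?A" for i
  proof (induction i)
    case (Suc i)
    have "es ! i \<noteq> e" using Suc.prems C(3) m by (simp add: e_def nth_eq_iff_index_eq)
    then have "es ! i \<in> E" "ends G (es ! i) = {vs ! i, vs ! Suc i}"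
      using C m Suc.prems by (auto simp: E_def)
    then have "(vs ! i, vs ! Suc i) \<in> conn ?A"
      by (intro conn_incl) (auto simp: adjacency_def)
    then show ?case using Suc conn_trans by fastforce
  qed simp
  then have "(vs ! m, vs ! 0) \<in> conn ?A" by (auto intro: conn_sym)
  then have "comps (verts G) (adjacency (G\<lparr>edges := insert e E\<rparr>)) = comps (verts G) ?A"
    unfolding comps_adjacency_insert[where E=E, OF e(2)] by (rule comps_insert_same)
  moreover have "insert e E = edges G" using e by (auto simp: E_def)
  moreover have "card (verts G) \<le> comps (verts G) ?A + card E"
    using assms by (intro card_le_comps) (auto simp: E_def)
  moreover have "card E < card (edges G)"
    unfolding E_def using e(1) assms(2) by (intro psubset_card_mono) auto
  ultimately show ?thesis by simp
qed

text \<open>Absence of cycles amounts to equality in \<open>card_le_comps\<close>. Together with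
  connectedness this is a condition on cardinalities only, so no cycle has to be constructed from
  here on.\<close>

lemma mg_tree_iff:
  assumes "finite (verts G)" "finite (edges G)"
    "\<forall>e\<in>edges G. \<exists>u\<in>verts G. \<exists>v\<in>verts G. ends G e = {u, v}"
  shows "mg_tree G \<longleftrightarrow> mg_connected G \<and> card (edges G) + 1 = card (verts G)"
proof -
  have "card (verts G) = comps (verts G) (adjacency G) + card (edges G)"
    if "\<nexists>vs es. mg_cycle G vs es"
    using acyclic_card_eq[OF assms(1,2,3)] that by simp
  moreover have "card (verts G) \<noteq> comps (verts G) (adjacency G) + card (edges G)"
    if "mg_cycle G vs es" for vs es
    using mg_cycle_card_less[OF assms that] by simp
  ultimately show ?thesis unfolding mg_tree_def mg_connected_iff
    by (cases "\<exists>vs es. mg_cycle G vs es") auto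
qed

section \<open>Cycles of permutations\<close>

definition gr :: "('a \<Rightarrow> 'a) \<Rightarrow> ('a \<times> 'a) set" where
  "gr p = range (\<lambda>x. (x, p x))"

lemma in_gr [simp]: "(x, y) \<in> gr p \<longleftrightarrow> y = p x"
  by (auto simp: gr_def)

text \<open>The symmetric closure adds nothing to the forward orbit: under a permutation of finite
  support, each point is reached again from its image.\<close>

lemma conn_gr:
  assumes "permutation p"
  shows "conn (gr p) `` {x} = Orbits.orbit p x"
proof (intro subset_antisym subsetI)
  fix y assume "y \<in> Orbits.orbit p x"
  then show "y \<in> conn (gr p) `` {x}"
    by induction (use conn_incl[of _ _ "gr p"] in \<open>auto intro: conn_trans\<close>)
next
  fix y assume "y \<in> conn (gr p) `` {x}"
  then have "(x, y) \<in> conn (gr p)" by simp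
  then show "y \<in> Orbits.orbit p x"
  proof (induction rule: conn_induct)
    case refl
    then show ?case by (rule permutation_self_in_orbit[OF assms])
  next
    case (step y z)
    show ?case
    proof (cases "z = p y")
      case True
      then show ?thesis using step.IH by (auto intro: Orbits.orbit.step)
    next
      case False
      then have "y = p z" using step by simp
      then have "z \<in> Orbits.orbit p y"
        using permutation_orbit_step[OF assms] permutation_self_in_orbit[OF assms] by metis
      then show ?thesis using step.IH by (rule orbit_trans)
    qed
  qed
qed

lemma in_conn_gr: "permutation p \<Longrightarrow> (x, y) \<in> conn (gr p) \<longleftrightarrow> y \<in> Orbits.orbit p x"
  using conn_gr[of p x] by blast

lemma orbit_eq_iff:
  assumes "permutation p"
  shows "Orbits.orbit p x = Orbits.orbit p y \<longleftrightarrow> y \<in> Orbits.orbit p x"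
  using class_eq_iff[of "gr p" x y] assms by (simp add: conn_gr in_conn_gr)

lemma num_cycles_comps: "permutation p \<Longrightarrow> num_cycles p A = comps A (gr p)"
  by (simp add: num_cycles_def perm_cycles_def comps_def conn_gr)

lemma permutation_of_permutes: "p permutes A \<Longrightarrow> finite A \<Longrightarrow> permutation p"
  by (auto simp: permutation_permutes)

section \<open>Effect of a transposition on cycles and components\<close>

lemma transpose_comp_self: "transpose a b \<circ> (transpose a b \<circ> p) = p"
  by (simp add: comp_assoc[symmetric])

text \<open>Once \<open>a\<close> and \<open>b\<close> are linked, exchanging them as values changes
  no class. Composing twice with the transposition restores \<open>p\<close>, so one inclusion
  yields the other. The extra relation \<open>s\<close> makes room for a second permutation in the
  genus inequality.\<close>

lemma conn_gr_transpose:
  "conn (insert (a, b) (s \<union> gr (transpose a b \<circ> p))) = conn (insert (a, b) (s \<union> gr p))"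
proof (rule conn_eqI)
  have *: "insert (a, b) (s \<union> gr (transpose a b \<circ> p)) \<subseteq> conn (insert (a, b) (s \<union> gr p))" for p
  proof
    let ?C = "conn (insert (a, b) (s \<union> gr p))"
    have ab: "(a, b) \<in> ?C" by (rule conn_incl) simp
    note ab = ab conn_sym[OF ab]
    fix e assume "e \<in> insert (a, b) (s \<union> gr (transpose a b \<circ> p))"
    then consider "e = (a, b)" | "e \<in> s" | x where "e = (x, transpose a b (p x))"
      by (auto simp: gr_def)
    then show "e \<in> ?C"
    proof cases
      case 2
      then show ?thesis by (cases e) (auto intro: conn_incl)
    next
      case 3
      have "(x, p x) \<in> ?C" by (rule conn_incl) simp
      moreover have "(p x, transpose a b (p x)) \<in> ?C"
        using ab by (auto simp: transpose_def)
      ultimately show ?thesis using 3 conn_trans by fast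
    qed (use ab in simp)
  qed
  show "insert (a, b) (s \<union> gr (transpose a b \<circ> p)) \<subseteq> conn (insert (a, b) (s \<union> gr p))"
    by (rule *)
  show "insert (a, b) (s \<union> gr p) \<subseteq> conn (insert (a, b) (s \<union> gr (transpose a b \<circ> p)))"
    using *[of "transpose a b \<circ> p"] by (simp only: transpose_comp_self)
qed

text \<open>Suppose \<open>b\<close> is not reached. The walk of \<open>p\<close> from
  \<open>a\<close> avoids \<open>b\<close> by assumption, and a return to \<open>a\<close> would be
  redirected to \<open>b\<close>. So the walk agrees with that of the new permutation, stays in the
  class \<open>K\<close>, and never returns to \<open>a\<close>, which is impossible for a
  permutation.\<close>

lemma transpose_merges:
  assumes "permutation p" "b \<notin> Orbits.orbit p a"
  shows "(a, b) \<in> conn (gr (transpose a b \<circ> p))"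
proof (rule ccontr)
  define K where "K = conn (gr (transpose a b \<circ> p)) `` {a}"
  assume "(a, b) \<notin> conn (gr (transpose a b \<circ> p))"
  then have b: "b \<notin> K" by (simp add: K_def)
  have K: "transpose a b (p y) \<in> K" if "y \<in> K" for y
    using that conn_trans[of a y _ "transpose a b (p y)"] conn_incl[of y "transpose a b (p y)"]
    by (simp add: K_def)
  have a: "a \<in> K" by (simp add: K_def)
  have *: "p y \<in> K \<and> p y \<noteq> a" if "y \<in> K" "p y \<in> Orbits.orbit p a" for y
  proof -
    have "p y \<noteq> b" using that(2) assms(2) by auto
    moreover have "p y \<noteq> a" using K[OF that(1)] b by auto
    ultimately show ?thesis using K[OF that(1)] by (simp add: transpose_def)
  qed
  have "y \<noteq> a \<and> y \<in> K" if "y \<in> Orbits.orbit p a" for y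
    using that
  proof induction
    case base
    then show ?case using *[OF a] Orbits.orbit.base by metis
  next
    case (step y)
    then show ?case using *[of y] Orbits.orbit.step by metis
  qed
  then show False using permutation_self_in_orbit[OF assms(1), of a] by blast
qed

lemma permutes_transpose_comp:
  "p permutes A \<Longrightarrow> a \<in> A \<Longrightarrow> b \<in> A \<Longrightarrow> transpose a b \<circ> p permutes A"
  by (simp add: permutes_compose permutes_swap_id)

text \<open>Linking \<open>a\<close> with \<open>b\<close> makes the component counts of both
  permutations equal and lowers each by at most one. If \<open>b\<close> is on another cycle, the
  link costs \<open>p\<close> exactly one component and the merged permutation none.\<close>

lemma num_cycles_transpose:
  assumes "finite A" "p permutes A" "a \<in> A" "b \<in> A"
  shows "num_cycles (transpose a b \<circ> p) A \<le> Suc (num_cycles p A)"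
    and "b \<notin> Orbits.orbit p a \<Longrightarrow> Suc (num_cycles (transpose a b \<circ> p) A) = num_cycles p A"
proof -
  let ?q = "transpose a b \<circ> p"
  have perm: "permutation p" "permutation ?q"
    using permutation_of_permutes[OF assms(2,1)]
      permutation_of_permutes[OF permutes_transpose_comp[OF assms(2,3,4)] assms(1)] by simp_all
  have eq: "comps A (insert (a, b) (gr ?q)) = comps A (insert (a, b) (gr p))"
    using conn_gr_transpose[of a b "{}" p] by (simp add: comps_def)
  show "num_cycles ?q A \<le> Suc (num_cycles p A)"
    using eq comps_insert_bounds[OF assms(1,3,4), of "gr p"]
      comps_insert_bounds[OF assms(1,3,4), of "gr ?q"]
    by (simp add: num_cycles_comps[OF perm(1)] num_cycles_comps[OF perm(2)])
  assume b: "b \<notin> Orbits.orbit p a"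
  then have "(a, b) \<notin> conn (gr p)" by (simp add: in_conn_gr[OF perm(1)])
  then show "Suc (num_cycles ?q A) = num_cycles p A"
    using eq comps_insert_diff[OF assms(1,3,4), of "gr p"]
      comps_insert_same[OF transpose_merges[OF perm(1) b], of A]
    by (simp add: num_cycles_comps[OF perm(1)] num_cycles_comps[OF perm(2)])
qed

lemma num_cycles_id: "num_cycles id A = card A"
  by (simp add: num_cycles_def perm_cycles_def orbit_eq_singleton_iff[THEN iffD2] card_image)

text \<open>Nonnegativity of the genus. Removing one point from the support of \<open>\<rho>\<close> amounts to a
  transposition, which joins two cycles of \<open>\<rho> \<circ> \<sigma>\<close> if it reduces the number of components.\<close>

lemma genus_inequality:
  assumes "finite A" "\<sigma> permutes A" "\<rho> permutes A"
  shows "num_cycles \<sigma> A + num_cycles \<rho> A + num_cycles (\<rho> \<circ> \<sigma>) A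
    \<le> card A + 2 * comps A (gr \<sigma> \<union> gr \<rho>)"
  using assms(3)
proof (induction "card {x. \<rho> x \<noteq> x}" arbitrary: \<rho> rule: less_induct)
  case less
  show ?case
  proof (cases "\<rho> = id")
    case True
    have "conn (gr \<sigma> \<union> gr id) = conn (gr \<sigma>)"
      by (rule conn_eqI) (auto intro: conn_incl)
    then show ?thesis using True num_cycles_comps[OF permutation_of_permutes[OF assms(2,1)]]
      by (simp add: num_cycles_id comps_def)
  next
    case False
    then obtain a where a: "\<rho> a \<noteq> a" by (auto simp: fun_eq_iff)
    \<comment> \<open>The transposition sends the value \<open>\<rho> a\<close> back to
      \<open>a\<close>, so \<open>q\<close> fixes \<open>a\<close>, and it moves no point that
      \<open>\<rho>\<close> fixes.\<close>
    define b where "b = \<rho> a"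
    define q where "q = transpose a b \<circ> \<rho>"
    have "a \<in> A" using a less.prems permutes_not_in by metis
    then have ab: "a \<in> A" "b \<in> A" "a \<noteq> b"
      using a less.prems by (auto simp: b_def permutes_in_image)
    have q: "q permutes A" "transpose a b \<circ> q = \<rho>" "q a = a"
      using less.prems ab permutes_transpose_comp
      by (auto simp: q_def transpose_comp_self b_def)
    have perm: "permutation q" "permutation (q \<circ> \<sigma>)"
      using permutation_of_permutes[OF q(1) assms(1)]
        permutation_of_permutes[OF permutes_compose[OF assms(2) q(1)] assms(1)] by simp_all
    have "{x. q x \<noteq> x} \<subset> {x. \<rho> x \<noteq> x}"
    proof -
      have "q x = x" if "\<rho> x = x" for x
      proof -
        have "x \<noteq> a" "x \<noteq> b"
          using that a permutes_inj[OF less.prems] by (auto simp: b_def dest: injD)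
        then show ?thesis using that by (simp add: q_def)
      qed
      then show ?thesis using a q(3) by blast
    qed
    moreover have "finite {x. \<rho> x \<noteq> x}"
      by (rule finite_subset[OF _ assms(1)]) (use less.prems in \<open>auto simp: permutes_def\<close>)
    ultimately have IH: "num_cycles \<sigma> A + num_cycles q A + num_cycles (q \<circ> \<sigma>) A
        \<le> card A + 2 * comps A (gr \<sigma> \<union> gr q)"
      using less.hyps[OF _ q(1)] psubset_card_mono by blast
    have "Orbits.orbit q a = {a}" using q(3) by (simp add: orbit_eq_singleton_iff)
    then have z: "Suc (num_cycles \<rho> A) = num_cycles q A"
      using num_cycles_transpose(2)[OF assms(1) q(1) ab(1,2)] ab(3) q(2) by simp
    \<comment> \<open>Linking \<open>a\<close> and \<open>b\<close> is free for
      \<open>\<rho>\<close>, which maps one to the other, so both permutations can be compared with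
      the link present.\<close>
    have "conn (gr \<sigma> \<union> gr \<rho>) = conn (insert (a, b) (gr \<sigma> \<union> gr \<rho>))"
      by (rule conn_insert_same[symmetric]) (auto simp: b_def intro: conn_incl)
    also have "\<dots> = conn (insert (a, b) (gr \<sigma> \<union> gr q))"
      using conn_gr_transpose[of a b "gr \<sigma>" q] by (simp add: q(2))
    finally have k: "comps A (gr \<sigma> \<union> gr \<rho>) = comps A (insert (a, b) (gr \<sigma> \<union> gr q))"
      by (simp add: comps_def)
    have comp: "\<rho> \<circ> \<sigma> = transpose a b \<circ> (q \<circ> \<sigma>)"
      using q(2) by (simp add: comp_assoc[symmetric])
    have qs: "q \<circ> \<sigma> permutes A" using q(1) assms(2) by (rule permutes_compose[rotated])
    show ?thesis
    \<comment> \<open>If \<open>a\<close> and \<open>b\<close> are already connected, the cycle lost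
      by \<open>\<rho>\<close> compensates a possible gain of one in the product. Otherwise both
      \<open>\<rho>\<close> and the product lose a cycle, which pays for the component counted with
      factor 2.\<close>
    proof (cases "(a, b) \<in> conn (gr \<sigma> \<union> gr q)")
      case True
      then show ?thesis
        using IH z k comps_insert_same[OF True, of A]
          num_cycles_transpose(1)[OF assms(1) qs ab(1,2)] by (simp add: comp)
    next
      case False
      have "gr (q \<circ> \<sigma>) \<subseteq> conn (gr \<sigma> \<union> gr q)"
      proof
        fix e assume "e \<in> gr (q \<circ> \<sigma>)"
        then obtain x where "e = (x, q (\<sigma> x))" by (auto simp: gr_def)
        moreover have "(x, \<sigma> x) \<in> conn (gr \<sigma> \<union> gr q)" "(\<sigma> x, q (\<sigma> x)) \<in> conn (gr \<sigma> \<union> gr q)"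
          by (rule conn_incl, simp)+
        ultimately show "e \<in> conn (gr \<sigma> \<union> gr q)" using conn_trans by fast
      qed
      then have "(a, b) \<notin> conn (gr (q \<circ> \<sigma>))" using False conn_least by blast
      then have "b \<notin> Orbits.orbit (q \<circ> \<sigma>) a" by (simp add: in_conn_gr[OF perm(2)])
      then show ?thesis
        using IH z k comps_insert_diff[OF assms(1) ab(1,2) False]
          num_cycles_transpose(2)[OF assms(1) qs ab(1,2)] by (simp add: comp)
    qed
  qed
qed

section \<open>From genus and faces to component counts\<close>

lemma conn_gr_inv:
  assumes "bij p" shows "conn (s \<union> gr (inv' p)) = conn (s \<union> gr p)"
proof -
  have "(x, y) \<in> gr (inv' p) \<longleftrightarrow> (y, x) \<in> gr p" for x y
    using assms by (auto simp: bij_is_surj surj_f_inv_f bij_is_inj)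
  then show ?thesis
    by (intro conn_eqI subrelI) (metis Un_iff conn_incl conn_sym)+
qed

lemma num_cycles_inv: "permutation p \<Longrightarrow> num_cycles (inv' p) A = num_cycles p A"
  by (simp add: num_cycles_def perm_cycles_def orbit_inv_eq)

lemma unicellular_of_tree_count:
  assumes "finite A" "\<sigma> permutes A" "\<theta> permutes A" "comps A (gr \<sigma> \<union> gr \<theta>) = 1"
    and "num_cycles \<sigma> A + num_cycles \<theta> A = card A + 1"
  shows "num_cycles (inv' \<theta> \<circ> \<sigma>) A = 1"
proof -
  have "num_cycles \<sigma> A + num_cycles (inv' \<theta>) A + num_cycles (inv' \<theta> \<circ> \<sigma>) A \<le> card A + 2"
    using genus_inequality[OF assms(1,2) permutes_inv[OF assms(3)]] assms(4)
    by (simp add: comps_def conn_gr_inv[OF permutes_bij[OF assms(3)]])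
  then have "num_cycles (inv' \<theta> \<circ> \<sigma>) A \<le> 1"
    using assms(5) by (simp add: num_cycles_inv[OF permutation_of_permutes[OF assms(3,1)]])
  moreover have "A \<noteq> {}" using assms(4) by (auto simp: comps_def)
  then have "num_cycles (inv' \<theta> \<circ> \<sigma>) A > 0"
    using assms(1) by (simp add: num_cycles_def perm_cycles_def card_gt_0_iff)
  ultimately show ?thesis by linarith
qed

text \<open>Group elements are words in the generators and their inverses, that is, walks in the
  symmetric closure of the two graphs. The bound on \<open>n\<close> matters: without points
  transitivity is vacuous, but the number of components is 0.\<close>

lemma hypermap_iff:
  assumes "n \<ge> 1"
  shows "hypermap n \<sigma> \<theta> \<longleftrightarrow>
    \<sigma> permutes {1..n} \<and> \<theta> permutes {1..n} \<and> comps {1..n} (gr \<sigma> \<union> gr \<theta>) = 1"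
proof (cases "\<sigma> permutes {1..n} \<and> \<theta> permutes {1..n}")
  case True
  let ?G = "generate (sym_group n) {\<sigma>, \<theta>}" and ?C = "conn (gr \<sigma> \<union> gr \<theta>)"
  have step: "(x, p x) \<in> ?C" if "p \<in> {\<sigma>, \<theta>}" for x p
    using that by (intro conn_incl) auto
  have inv: "inv\<^bsub>sym_group n\<^esub> p = inv' p" "bij p" if "p \<in> {\<sigma>, \<theta>}" for p
    using that True by (auto simp: sym_group_carrier permutes_bij)
  have "(x, p x) \<in> ?C" if "p \<in> ?G" for x p
    using that
  proof (induction arbitrary: x)
    case one
    then show ?case by (simp add: sym_group_one)
  next
    case (incl h)
    then show ?case by (rule step)
  next
    case (inv h)
    then show ?case
      using step[OF inv, of "inv' h x"] \<open>\<And>p. p \<in> {\<sigma>, \<theta>} \<Longrightarrow> inv\<^bsub>sym_group n\<^esub> p = inv' p\<close>[OF inv]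
        \<open>\<And>p. p \<in> {\<sigma>, \<theta>} \<Longrightarrow> bij p\<close>[OF inv]
      by (metis bij_is_surj conn_sym surj_f_inv_f)
  next
    case (eng h1 h2)
    then show ?case by (simp add: sym_group_mult) (metis conn_trans)
  qed
  moreover have "\<exists>p\<in>?G. p x = y" if "(x, y) \<in> ?C" for x y
    using that
  proof (induction rule: conn_induct)
    case refl
    show ?case using generate.one[of "sym_group n"] by (metis sym_group_one id_apply)
  next
    case (step y z)
    then obtain p where p: "p \<in> ?G" "p x = y" by blast
    have "\<exists>q\<in>?G. q y = z"
    proof -
      from step consider h where "h \<in> {\<sigma>, \<theta>}" "z = h y" | h where "h \<in> {\<sigma>, \<theta>}" "y = h z" by auto
      then show ?thesis
      proof cases
        case 1
        then show ?thesis by (auto intro: generate.incl)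
      next
        case 2
        then show ?thesis using generate.inv[OF 2(1), of "sym_group n"] inv[OF 2(1)]
          by (metis bij_is_inj inv_f_f)
      qed
    qed
    then show ?case using p generate.eng[of _ "sym_group n"]
      by (metis comp_apply sym_group_mult)
  qed
  ultimately have "(\<exists>p\<in>?G. p x = y) \<longleftrightarrow> (x, y) \<in> ?C" for x y by blast
  moreover have "{1..n} \<noteq> {}" using assms by simp
  ultimately show ?thesis using True unfolding hypermap_def comps_1_iff by simp
qed (auto simp: hypermap_def)

text \<open>With a single face, genus zero reads \<open>z(\<sigma>) + z(\<theta>) = n + 1\<close>.
  Conversely, this count and transitivity force a single face, so the product with the inverse of
  \<open>\<theta>\<close> drops out of the condition.\<close>

lemma spanning_hypertree_iff:
  assumes "n \<ge> 1" "\<sigma> permutes {1..n}"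
  shows "spanning_hypertree n \<sigma> \<alpha> \<theta> \<longleftrightarrow>
    refinement n \<alpha> \<theta> \<and> comps {1..n} (gr \<sigma> \<union> gr \<theta>) = 1 \<and>
    num_cycles \<sigma> {1..n} + num_cycles \<theta> {1..n} = n + 1"
proof -
  let ?u = "num_cycles (inv' \<theta> \<circ> \<sigma>) {1..n}" and ?s = "num_cycles \<sigma> {1..n} + num_cycles \<theta> {1..n}"
  have "genus {1..n} \<sigma> \<theta> = 0 \<longleftrightarrow> (of_nat (n + 2) :: rat) = of_nat (?s + ?u)"
    unfolding genus_def by (simp add: add_ac)
  then have "genus {1..n} \<sigma> \<theta> = 0 \<and> unicellular n \<sigma> \<theta> \<longleftrightarrow> ?u = 1 \<and> ?s = n + 1"
    unfolding of_nat_eq_iff unicellular_def by auto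
  moreover have "refinement n \<alpha> \<theta> \<Longrightarrow> \<theta> permutes {1..n}" by (simp add: refinement_def)
  moreover have "?u = 1"
    if "\<theta> permutes {1..n}" "comps {1..n} (gr \<sigma> \<union> gr \<theta>) = 1" "?s = n + 1"
    using unicellular_of_tree_count[OF _ assms(2) that(1,2)] that(3) by simp
  ultimately show ?thesis
    unfolding spanning_hypertree_def hypermap_iff[OF assms(1)] using assms(2) by blast
qed

section \<open>Refinements\<close>

text \<open>Each fixed point is a cycle of its own; the remaining cycles are the orbits of the moved
  points. The equation is arranged to avoid subtraction.\<close>

lemma num_cycles_support:
  assumes "finite A" "p permutes A"
  shows "num_cycles p A + card {x \<in> A. p x \<noteq> x} = card A + card (Orbits.orbit p ` {x \<in> A. p x \<noteq> x})"
proof -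
  let ?S = "{x \<in> A. p x \<noteq> x}" and ?o = "Orbits.orbit p"
  have fixed: "?o x = {x}" if "x \<in> A - ?S" for x
    using that by (auto simp: orbit_eq_singleton_iff)
  have "?o ` ?S \<inter> ?o ` (A - ?S) = {}"
  proof (rule ccontr)
    assume "?o ` ?S \<inter> ?o ` (A - ?S) \<noteq> {}"
    then obtain x y where "x \<in> ?S" "y \<in> A - ?S" "?o x = ?o y" by blast
    then have "?o x = {y}" using fixed by simp
    moreover have "x \<in> ?o x" by (rule permutation_self_in_orbit[OF permutation_of_permutes[OF assms(2,1)]])
    ultimately show False using \<open>x \<in> ?S\<close> \<open>y \<in> A - ?S\<close> by auto
  qed
  moreover have "?o ` A = ?o ` ?S \<union> ?o ` (A - ?S)" by blast
  moreover have "card (?o ` (A - ?S)) = card (A - ?S)"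
    by (rule card_image) (auto simp: inj_on_def fixed)
  moreover have "card (A - ?S) + card ?S = card A"
  proof -
    have "card (A - ?S) = card A - card ?S" by (rule card_Diff_subset) (use assms(1) in auto)
    moreover have "card ?S \<le> card A" by (rule card_mono) (use assms(1) in auto)
    ultimately show ?thesis by simp
  qed
  ultimately show ?thesis
    unfolding num_cycles_def perm_cycles_def using assms(1) by (simp add: card_Un_disjoint)
qed

text \<open>Two nontrivial cycles would move at least four points, so at most three moved points
  form at most one nontrivial cycle.\<close>

lemma num_cycles_small:
  assumes "finite A" "p permutes A" "card {x \<in> A. p x \<noteq> x} \<le> 3"
  shows "num_cycles p A + card {x \<in> A. p x \<noteq> x} = card A + of_bool (card {x \<in> A. p x \<noteq> x} > 0)"
proof -
  let ?S = "{x \<in> A. p x \<noteq> x}" and ?o = "Orbits.orbit p"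
  have perm: "permutation p" using assms by (simp add: permutation_of_permutes)
  have S: "p x \<in> ?S" if "x \<in> ?S" for x
    using that assms(2) permutes_inj[OF assms(2)] by (auto simp: permutes_in_image dest: injD)
  have sub: "?o x \<subseteq> ?S" if "x \<in> ?S" for x
  proof
    fix y assume "y \<in> ?o x" then show "y \<in> ?S" by induction (use S that in blast)+
  qed
  have "?o x = ?o y" if "x \<in> ?S" "y \<in> ?S" for x y
  proof (rule ccontr)
    assume "?o x \<noteq> ?o y"
    then have "?o x \<inter> ?o y = {}" using orbit_eq_iff[OF perm] by blast
    moreover have two: "2 \<le> card (?o z)" if "z \<in> ?S" for z
    proof -
      have "card {z, p z} \<le> card (?o z)"
        using permutation_self_in_orbit[OF perm, of z]
        by (intro card_mono finite_orbit) (auto intro: Orbits.orbit.base)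
      then show ?thesis using that by (simp add: eq_commute)
    qed
    moreover have "card (?o x \<union> ?o y) \<le> card ?S"
      using sub that assms(1) by (intro card_mono) auto
    moreover have "finite (?o x)" "finite (?o y)"
      using permutation_self_in_orbit[OF perm] finite_orbit by metis+
    ultimately have "card (?o x) + card (?o y) \<le> 3"
      using assms(3) card_Un_disjoint[of "?o x" "?o y"] by linarith
    then show False using two[OF that(1)] two[OF that(2)] by simp
  qed
  then have "card (?o ` ?S) = of_bool (card ?S > 0)"
  proof (cases "?S = {}")
    case False
    then obtain x where x: "x \<in> ?S" by blast
    then have "?o ` ?S = {?o x}" using \<open>\<And>y x. x \<in> ?S \<Longrightarrow> y \<in> ?S \<Longrightarrow> ?o x = ?o y\<close> by blast
    moreover have "card ?S > 0" using x assms(1) by (auto simp: card_gt_0_iff)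
    ultimately show ?thesis by simp
  next
    case True
    then show ?thesis unfolding True by simp
  qed
  then show ?thesis using num_cycles_support[OF assms(1,2)] by simp
qed

lemma perm_restrict_permutes:
  assumes "finite c" "inj p" "p ` c = c"
  shows "perm_restrict p c permutes c"
proof (rule bij_imp_permutes)
  show "bij_betw (perm_restrict p c) c c"
    using assms(2,3) by (auto simp: bij_betw_def inj_on_def perm_restrict_simps dest: injD)
qed (simp add: perm_restrict_simps)

text \<open>Here \<open>c\<close> is one cycle of \<open>\<alpha>\<close>, and \<open>s\<close>,
  \<open>s'\<close> count the points moved by \<open>\<theta>\<close> and by
  \<open>inv' \<alpha> \<circ> \<theta>\<close>. By \<open>num_cycles_small\<close> these numbers
  determine all cycle counts, so genus zero becomes an arithmetic condition that can be checked
  pointwise.\<close>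

lemma genus_restrict_iff:
  assumes "finite c" "card c \<le> 3" "inj \<theta>" "inj \<alpha>" "\<theta> ` c = c" "\<alpha> ` c = c"
    and cyc: "c \<noteq> {}" "\<And>x. x \<in> c \<Longrightarrow> Orbits.orbit \<alpha> x = c"
    and s: "s = card {x \<in> c. \<theta> x \<noteq> x}" and s': "s' = card {x \<in> c. \<theta> x \<noteq> \<alpha> x}"
  shows "genus c (perm_restrict \<theta> c) (perm_restrict \<alpha> c) = 0 \<longleftrightarrow>
    s + s' + 1 = card c + of_bool (s > 0) + of_bool (s' > 0)"
proof -
  let ?t = "perm_restrict \<theta> c" and ?a = "perm_restrict \<alpha> c"
  have t: "?t permutes c" and a: "?a permutes c"
    using assms by (simp_all add: perm_restrict_permutes)
  have at: "inv' ?a \<circ> ?t permutes c" using t a by (simp add: permutes_compose permutes_inv)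
  have le: "card {x \<in> c. P x} \<le> 3" for P
    using card_mono[of c "{x \<in> c. P x}"] assms(1,2) by auto
  have "Orbits.orbit ?a x = c" if "x \<in> c" for x
  proof -
    have "Orbits.orbit ?a x = Orbits.orbit \<alpha> x"
      using that assms(6) by (intro orbit_cong0[of _ c]) (auto simp: perm_restrict_simps)
    then show ?thesis using cyc(2)[OF that] by simp
  qed
  then have "Orbits.orbit ?a ` c = {c}" using cyc(1) by auto
  then have za: "num_cycles ?a c = 1" by (simp add: num_cycles_def perm_cycles_def)
  have "{x \<in> c. ?t x \<noteq> x} = {x \<in> c. \<theta> x \<noteq> x}" by (auto simp: perm_restrict_simps)
  then have zt: "num_cycles ?t c + s = card c + of_bool (s > 0)"
    using num_cycles_small[OF assms(1) t] le s by simp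
  have "(inv' ?a \<circ> ?t) x \<noteq> x \<longleftrightarrow> \<theta> x \<noteq> \<alpha> x" if "x \<in> c" for x
    using that permutes_inv_eq[OF a, of "\<theta> x" x] by (auto simp: perm_restrict_simps)
  then have "{x \<in> c. (inv' ?a \<circ> ?t) x \<noteq> x} = {x \<in> c. \<theta> x \<noteq> \<alpha> x}" by blast
  then have zat: "num_cycles (inv' ?a \<circ> ?t) c + s' = card c + of_bool (s' > 0)"
    using num_cycles_small[OF assms(1) at] le s' by simp
  have "genus c ?t ?a = 0 \<longleftrightarrow>
    (of_nat (card c + 2) :: rat) = of_nat (num_cycles ?t c + num_cycles ?a c + num_cycles (inv' ?a \<circ> ?t) c)"
    unfolding genus_def by (simp add: add_ac)
  then show ?thesis unfolding of_nat_eq_iff using za zt zat by linarith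
qed

section \<open>Cycles of at most three points and first return maps\<close>

lemma orbit_short:
  assumes "permutation \<alpha>" "card (Orbits.orbit \<alpha> i) \<le> 3"
  shows "Orbits.orbit \<alpha> i = {i, \<alpha> i, \<alpha> (\<alpha> i)}"
proof -
  let ?S = "{i, \<alpha> i, \<alpha> (\<alpha> i)}"
  have inj: "\<alpha> x = \<alpha> y \<longleftrightarrow> x = y" for x y
    using assms(1) by (meson bij_is_inj inj_eq permutation_bijective)
  have fin: "finite (Orbits.orbit \<alpha> i)"
    using assms(1) by (simp add: finite_orbit permutation_self_in_orbit)
  have sub: "?S \<subseteq> Orbits.orbit \<alpha> i"
    using permutation_self_in_orbit[OF assms(1), of i] by (auto intro: Orbits.orbit.intros)
  show ?thesis
  proof (cases "\<alpha> i = i \<or> \<alpha> (\<alpha> i) = i")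
    case True
    have "y \<in> ?S" if "y \<in> Orbits.orbit \<alpha> i" for y
      using that by induction (use True in auto)
    then show ?thesis using sub by blast
  next
    case False
    then have "card ?S = 3" by (auto simp: inj eq_commute)
    then show ?thesis using card_subset_eq[OF fin sub] card_mono[OF fin sub] assms(2) by simp
  qed
qed

lemma orbit_short_cases:
  assumes "permutation \<alpha>" "card (Orbits.orbit \<alpha> i) \<le> 3"
  obtains (1) "\<alpha> i = i" "Orbits.orbit \<alpha> i = {i}"
  | (2) "\<alpha> i \<noteq> i" "\<alpha> (\<alpha> i) = i" "Orbits.orbit \<alpha> i = {i, \<alpha> i}"
  | (3) "\<alpha> i \<noteq> i" "\<alpha> (\<alpha> i) \<noteq> i" "\<alpha> (\<alpha> i) \<noteq> \<alpha> i" "\<alpha> (\<alpha> (\<alpha> i)) = i"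
        "Orbits.orbit \<alpha> i = {i, \<alpha> i, \<alpha> (\<alpha> i)}"
proof -
  have inj: "\<alpha> x = \<alpha> y \<longleftrightarrow> x = y" for x y
    using assms(1) by (meson bij_is_inj inj_eq permutation_bijective)
  have S: "Orbits.orbit \<alpha> i = {i, \<alpha> i, \<alpha> (\<alpha> i)}" by (rule orbit_short[OF assms])
  have "\<alpha> (\<alpha> (\<alpha> i)) \<in> Orbits.orbit \<alpha> i" by (intro Orbits.orbit.intros)
  then have "\<alpha> (\<alpha> (\<alpha> i)) = i \<or> \<alpha> (\<alpha> i) = i \<or> \<alpha> i = i" unfolding S by (auto simp: inj)
  then consider "\<alpha> i = i" | "\<alpha> i \<noteq> i" "\<alpha> (\<alpha> i) = i"
    | "\<alpha> i \<noteq> i" "\<alpha> (\<alpha> i) \<noteq> i" "\<alpha> (\<alpha> (\<alpha> i)) = i" by blast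
  then show ?thesis
  proof cases
    case 1 then show ?thesis using S by (intro that(1)) auto
  next
    case 2 then show ?thesis using S by (intro that(2)) auto
  next
    case 3 then show ?thesis using S by (intro that(3)) (auto simp: inj)
  qed
qed

text \<open>The permutation induced by \<open>\<alpha>\<close> on \<open>P\<close>, extended by the
  identity. Two steps of lookahead suffice on short cycles: if both fail, the next point of
  \<open>P\<close> on the cycle is \<open>i\<close> itself.\<close>

definition first_return :: "('a \<Rightarrow> 'a) \<Rightarrow> 'a set \<Rightarrow> 'a \<Rightarrow> 'a" where
  "first_return \<alpha> P i =
     (if i \<notin> P then i else if \<alpha> i \<in> P then \<alpha> i else if \<alpha> (\<alpha> i) \<in> P then \<alpha> (\<alpha> i) else i)"

text \<open>The links forget the cyclic order, which the graph side does not see, but generate the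
  same classes as the first return map.\<close>

definition cycle_links :: "('a \<Rightarrow> 'a) \<Rightarrow> 'a set \<Rightarrow> ('a \<times> 'a) set" where
  "cycle_links \<alpha> P = {(i, j). i \<in> P \<and> j \<in> P \<and> j \<in> Orbits.orbit \<alpha> i}"

locale short_pair =
  fixes n :: nat and \<sigma> \<alpha> :: "nat \<Rightarrow> nat"
  assumes n: "n \<ge> 1" and \<sigma>: "\<sigma> permutes {1..n}" and \<alpha>: "\<alpha> permutes {1..n}"
    and short: "short_hyperedges n \<alpha>"
begin

abbreviation "N \<equiv> {1..n}"
abbreviation "cyc \<equiv> Orbits.orbit \<alpha>"
abbreviation "cycles \<equiv> perm_cycles \<alpha> N"

definition hit :: "nat set \<Rightarrow> nat set set" where
  "hit P = {c \<in> cycles. c \<inter> P \<noteq> {}}"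

definition good :: "nat set \<Rightarrow> bool" where
  "good P \<longleftrightarrow> P \<subseteq> N \<and> (\<forall>i\<in>P. \<exists>j\<in>P. j \<noteq> i \<and> j \<in> cyc i)"

text \<open>For good \<open>P\<close> the second conjunct is
  \<open>z(\<sigma>) + z(\<theta>) = n + 1\<close> with
  \<open>\<theta> = first_return \<alpha> P\<close>, since
  \<open>z(\<theta>) = n - |P| + |hit P|\<close>. It also makes sense for sets with lonely points,
  where only the graph side uses it.\<close>

definition tree_set :: "nat set \<Rightarrow> bool" where
  "tree_set P \<longleftrightarrow> comps N (gr \<sigma> \<union> cycle_links \<alpha> P) = 1 \<and>
     card P + 1 = num_cycles \<sigma> N + card (hit P)"

lemma perm: "permutation \<alpha>"
  using \<alpha> by (simp add: permutation_of_permutes)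

lemma inj_\<alpha>: "\<alpha> x = \<alpha> y \<longleftrightarrow> x = y"
  using permutes_inj[OF \<alpha>] by (simp add: inj_eq)

lemma self_cyc: "i \<in> cyc i"
  by (rule permutation_self_in_orbit[OF perm])

lemma cyc_eq_iff: "cyc i = cyc j \<longleftrightarrow> j \<in> cyc i"
  by (rule orbit_eq_iff[OF perm])

lemma cyc_short: "card (cyc i) \<le> 3"
proof (cases "i \<in> N")
  case True
  then show ?thesis using short by (simp add: short_hyperedges_def perm_cycles_def)
next
  case False
  then have "cyc i = {i}" using permutes_not_in[OF \<alpha>] by (simp add: orbit_eq_singleton_iff)
  then show ?thesis by simp
qed

lemmas cyc_cases = orbit_short_cases[OF perm cyc_short]

lemma cyc_subset: "i \<in> N \<Longrightarrow> cyc i \<subseteq> N"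
  by (rule permutes_orbit_subset[OF \<alpha>])

lemma cyc_finite: "finite (cyc i)"
  using self_cyc by (rule finite_orbit)

lemma first_return_in_cyc: "first_return \<alpha> P i \<in> cyc i"
  using self_cyc by (auto simp: first_return_def intro: Orbits.orbit.intros)

lemma first_return_in: "first_return \<alpha> P i \<in> P \<longleftrightarrow> i \<in> P"
  by (auto simp: first_return_def)

lemma inj_first_return: "inj (first_return \<alpha> P)"
proof (rule injI)
  fix i j assume eq: "first_return \<alpha> P i = first_return \<alpha> P j"
  have "i \<in> P \<longleftrightarrow> j \<in> P" using first_return_in[of P i] first_return_in[of P j] eq by simp
  moreover have "i = j" if "i \<in> P" "j \<in> P"
    using eq that cyc_cases[of i] cyc_cases[of j]
    unfolding first_return_def by (smt (verit) inj_\<alpha>)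
  ultimately show "i = j" using eq by (auto simp: first_return_def)
qed

lemma first_return_permutes:
  assumes "P \<subseteq> N" shows "first_return \<alpha> P permutes N"
proof (rule bij_imp_permutes)
  have "first_return \<alpha> P ` N \<subseteq> N" using first_return_in_cyc cyc_subset by blast
  then show "bij_betw (first_return \<alpha> P) N N"
    using inj_on_subset[OF inj_first_return subset_UNIV]
    by (simp add: bij_betw_def endo_inj_surj del: One_nat_def)
  show "first_return \<alpha> P x = x" if "x \<notin> N" for x
    using that assms by (auto simp: first_return_def)
qed

text \<open>A point of \<open>P\<close> that is not lonely has another point of \<open>P\<close> one
  or two steps ahead. So a good set can be read off from its first return map.\<close>

lemma first_return_moves:
  assumes "good P" shows "first_return \<alpha> P i \<noteq> i \<longleftrightarrow> i \<in> P"
proof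
  assume i: "i \<in> P"
  then obtain j where "j \<in> P" "j \<noteq> i" "j \<in> {i, \<alpha> i, \<alpha> (\<alpha> i)}"
    using assms orbit_short[OF perm cyc_short] by (auto simp: good_def)
  then show "first_return \<alpha> P i \<noteq> i" using i by (auto simp: first_return_def)
qed (auto simp: first_return_def split: if_splits)

lemma orbit_first_return:
  assumes "P \<subseteq> N" "i \<in> P" shows "Orbits.orbit (first_return \<alpha> P) i = P \<inter> cyc i"
proof (intro subset_antisym subsetI)
  fix y assume "y \<in> Orbits.orbit (first_return \<alpha> P) i"
  then show "y \<in> P \<inter> cyc i"
  proof induction
    case base
    then show ?case using assms(2) first_return_in first_return_in_cyc by blast
  next
    case (step y)
    then show ?case
      using first_return_in orbit_trans[OF first_return_in_cyc[of P y], of i] by simp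
  qed
next
  fix y assume y: "y \<in> P \<inter> cyc i"
  let ?p = "first_return \<alpha> P"
  have "permutation ?p"
    using first_return_permutes[OF assms(1)] by (simp add: permutation_of_permutes)
  then have self: "i \<in> Orbits.orbit ?p i" by (rule permutation_self_in_orbit)
  have "y = i \<or> y = \<alpha> i \<or> y = \<alpha> (\<alpha> i)" using y orbit_short[OF perm cyc_short, of i] by auto
  then consider "y = i" | "y = ?p i" | "\<alpha> i \<in> P" "y = \<alpha> (\<alpha> i)"
    using y assms(2) by (cases "\<alpha> i \<in> P") (auto simp: first_return_def)
  then show "y \<in> Orbits.orbit ?p i"
  proof cases
    case 3
    then have "\<alpha> i = ?p i" "y = ?p (\<alpha> i)" using y assms(2) by (auto simp: first_return_def)
    then show ?thesis by (simp add: Orbits.orbit.intros)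
  qed (use self Orbits.orbit.base in simp_all)
qed

lemma cycle_eq: "c \<in> cycles \<Longrightarrow> x \<in> c \<Longrightarrow> c = cyc x"
  using cyc_eq_iff unfolding perm_cycles_def by (metis imageE)

text \<open>The nontrivial cycles of the first return map are the traces \<open>P \<inter> c\<close>
  of the hit cycles; these traces are nonempty, hence distinct for distinct cycles.\<close>

lemma num_cycles_first_return:
  assumes "good P"
  shows "num_cycles (first_return \<alpha> P) N + card P = n + card (hit P)"
proof -
  let ?p = "first_return \<alpha> P"
  have P: "P \<subseteq> N" using assms by (simp add: good_def)
  have supp: "{x \<in> N. ?p x \<noteq> x} = P" using first_return_moves[OF assms] P by blast
  have "Orbits.orbit ?p ` P = (\<lambda>c. P \<inter> c) ` hit P"
  proof -
    have "Orbits.orbit ?p ` P = (\<lambda>i. P \<inter> cyc i) ` P"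
      by (rule image_cong) (simp_all add: orbit_first_return[OF P])
    also have "\<dots> = (\<lambda>c. P \<inter> c) ` cyc ` P" by (simp add: image_image)
    also have "cyc ` P = hit P"
    proof (intro subset_antisym subsetI)
      fix c assume "c \<in> hit P"
      then obtain x where "c \<in> cycles" "x \<in> c" "x \<in> P" by (auto simp: hit_def)
      then show "c \<in> cyc ` P" using cycle_eq by blast
    qed (use P self_cyc in \<open>auto simp: hit_def perm_cycles_def\<close>)
    finally show ?thesis .
  qed
  moreover have "inj_on (\<lambda>c. P \<inter> c) (hit P)"
  proof (rule inj_onI)
    fix c d assume cd: "c \<in> hit P" "d \<in> hit P" "P \<inter> c = P \<inter> d"
    then obtain x where "x \<in> c" "x \<in> d" by (auto simp: hit_def)
    then show "c = d" using cd cycle_eq unfolding hit_def by blast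
  qed
  ultimately have "card (Orbits.orbit ?p ` P) = card (hit P)" by (simp add: card_image)
  then show ?thesis
    using num_cycles_support[OF _ first_return_permutes[OF P]] unfolding supp by simp
qed

lemma conn_first_return:
  assumes "good P"
  shows "conn (gr \<sigma> \<union> gr (first_return \<alpha> P)) = conn (gr \<sigma> \<union> cycle_links \<alpha> P)"
proof (rule conn_eqI)
  let ?p = "first_return \<alpha> P"
  have P: "P \<subseteq> N" using assms by (simp add: good_def)
  have perm: "permutation ?p"
    using first_return_permutes[OF P] by (simp add: permutation_of_permutes)
  show "gr \<sigma> \<union> gr ?p \<subseteq> conn (gr \<sigma> \<union> cycle_links \<alpha> P)"
  proof (rule subrelI)
    fix x y assume "(x, y) \<in> gr \<sigma> \<union> gr ?p"
    then consider "(x, y) \<in> gr \<sigma>" | "x \<in> P" "y = ?p x" | "x = y"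
      by (auto simp: first_return_def split: if_splits)
    then show "(x, y) \<in> conn (gr \<sigma> \<union> cycle_links \<alpha> P)"
    proof cases
      case 2
      then show ?thesis using first_return_in first_return_in_cyc
        by (intro conn_incl) (simp add: cycle_links_def)
    qed (auto intro: conn_incl)
  qed
  show "gr \<sigma> \<union> cycle_links \<alpha> P \<subseteq> conn (gr \<sigma> \<union> gr ?p)"
  proof (rule subrelI)
    fix x y assume "(x, y) \<in> gr \<sigma> \<union> cycle_links \<alpha> P"
    then consider "(x, y) \<in> gr \<sigma>" | "y \<in> Orbits.orbit ?p x"
      using orbit_first_return[OF P] by (auto simp: cycle_links_def)
    then show "(x, y) \<in> conn (gr \<sigma> \<union> gr ?p)"
    proof cases
      case 2
      then have "(x, y) \<in> conn (gr ?p)" by (simp add: in_conn_gr[OF perm])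
      then show ?thesis using conn_mono[of "gr ?p" "gr \<sigma> \<union> gr ?p"] by blast
    qed (auto intro: conn_incl)
  qed
qed

lemma cyc_image: "\<alpha> ` cyc i = cyc i"
  using cyc_finite by (intro endo_inj_surj) (auto simp: inj_on_def inj_\<alpha> intro: Orbits.orbit.step)

lemma genus_restrict_cyc_iff:
  assumes "inj \<theta>" "\<theta> ` cyc i = cyc i"
    and s: "s = card {x \<in> cyc i. \<theta> x \<noteq> x}" and s': "s' = card {x \<in> cyc i. \<theta> x \<noteq> \<alpha> x}"
  shows "genus (cyc i) (perm_restrict \<theta> (cyc i)) (perm_restrict \<alpha> (cyc i)) = 0 \<longleftrightarrow>
    s + s' + 1 = card (cyc i) + of_bool (s > 0) + of_bool (s' > 0)"
proof (rule genus_restrict_iff[OF cyc_finite cyc_short assms(1) _ assms(2) cyc_image _ _ s s'])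
  show "inj \<alpha>" using permutes_inj[OF \<alpha>] .
  show "cyc i \<noteq> {}" using self_cyc by blast
  show "cyc x = cyc i" if "x \<in> cyc i" for x using that cyc_eq_iff by blast
qed

text \<open>As a sum of indicators the cardinality can be evaluated by simplification once the cycle
  is written out point by point.\<close>

lemma card_filter: "finite A \<Longrightarrow> card {x \<in> A. Q x} = (\<Sum>x\<in>A. of_bool (Q x))"
  by (simp add: sum.If_cases of_bool_def Collect_conj_eq Int_commute)

text \<open>A finite check by the length of the cycle and by which of its points lie in
  \<open>P\<close>. On a 3-cycle the pairs of numbers in the genus criterion are
  \<open>(0, 3)\<close>, \<open>(2, 2)\<close> and \<open>(3, 0)\<close>.\<close>

lemma refinement_first_return:
  assumes "good P" shows "refinement n \<alpha> (first_return \<alpha> P)"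
proof -
  let ?p = "first_return \<alpha> P"
  have P: "P \<subseteq> N" using assms by (simp add: good_def)
  have "?p ` cyc i = cyc i" for i
  proof (rule endo_inj_surj[OF cyc_finite])
    show "?p ` cyc i \<subseteq> cyc i" using orbit_trans[OF first_return_in_cyc] by auto
    show "inj_on ?p (cyc i)" using inj_first_return by (rule inj_on_subset) simp
  qed
  moreover have "genus (cyc i) (perm_restrict ?p (cyc i)) (perm_restrict \<alpha> (cyc i)) = 0" for i
    unfolding genus_restrict_cyc_iff[OF inj_first_return calculation refl refl]
      card_filter[OF cyc_finite]
  proof (cases i rule: cyc_cases)
    case 1
    then show "(\<Sum>x\<in>cyc i. of_bool (?p x \<noteq> x)) + (\<Sum>x\<in>cyc i. of_bool (?p x \<noteq> \<alpha> x)) + 1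
      = card (cyc i) + of_bool (0 < (\<Sum>x\<in>cyc i. of_bool (?p x \<noteq> x) :: nat))
        + of_bool (0 < (\<Sum>x\<in>cyc i. of_bool (?p x \<noteq> \<alpha> x) :: nat))"
      by (auto simp: first_return_def)
  next
    case 2
    then show "(\<Sum>x\<in>cyc i. of_bool (?p x \<noteq> x)) + (\<Sum>x\<in>cyc i. of_bool (?p x \<noteq> \<alpha> x)) + 1
      = card (cyc i) + of_bool (0 < (\<Sum>x\<in>cyc i. of_bool (?p x \<noteq> x) :: nat))
        + of_bool (0 < (\<Sum>x\<in>cyc i. of_bool (?p x \<noteq> \<alpha> x) :: nat))"
      by (cases "i \<in> P"; cases "\<alpha> i \<in> P") (simp_all add: first_return_def)
  next
    case 3
    note ne = 3(1,2,3) 3(1,2,3)[symmetric]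
    show "(\<Sum>x\<in>cyc i. of_bool (?p x \<noteq> x)) + (\<Sum>x\<in>cyc i. of_bool (?p x \<noteq> \<alpha> x)) + 1
      = card (cyc i) + of_bool (0 < (\<Sum>x\<in>cyc i. of_bool (?p x \<noteq> x) :: nat))
        + of_bool (0 < (\<Sum>x\<in>cyc i. of_bool (?p x \<noteq> \<alpha> x) :: nat))"
      unfolding 3(5)
      by (cases "i \<in> P"; cases "\<alpha> i \<in> P"; cases "\<alpha> (\<alpha> i) \<in> P")
        (simp_all add: first_return_def 3(4) ne)
  qed
  ultimately show ?thesis
    using first_return_permutes[OF P] by (auto simp: refinement_def perm_cycles_def)
qed

text \<open>On a cycle of at most two points every permutation is a first return map. On a 3-cycle
  only the inverse cycle is not, and that one is excluded by its genus.\<close>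

lemma refinement_support:
  assumes "refinement n \<alpha> \<theta>"
  shows "good {i. \<theta> i \<noteq> i}" "\<theta> = first_return \<alpha> {i. \<theta> i \<noteq> i}"
proof -
  let ?P = "{i. \<theta> i \<noteq> i}"
  have \<theta>: "\<theta> permutes N" and img: "\<And>i. i \<in> N \<Longrightarrow> \<theta> ` cyc i = cyc i"
    and gen: "\<And>i. i \<in> N \<Longrightarrow> genus (cyc i) (perm_restrict \<theta> (cyc i)) (perm_restrict \<alpha> (cyc i)) = 0"
    using assms by (auto simp: refinement_def perm_cycles_def)
  have inj: "\<theta> x = \<theta> y \<longleftrightarrow> x = y" for x y using permutes_inj[OF \<theta>] by (simp add: inj_eq)
  have N: "i \<in> N" if "i \<in> ?P" for i using that permutes_not_in[OF \<theta>] by auto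
  \<comment> \<open>The companion required by \<open>good\<close> is \<open>\<theta> i\<close>: it
    is on the same cycle and is moved as well.\<close>
  have "\<theta> i \<in> cyc i" if "i \<in> ?P" for i using img[OF N[OF that]] self_cyc by blast
  moreover have "\<theta> i \<in> ?P" if "i \<in> ?P" for i using that by (simp add: inj)
  ultimately show "good ?P" using N unfolding good_def by fast
  have "\<theta> i = first_return \<alpha> ?P i" if i: "i \<in> N" for i
  proof (cases i rule: cyc_cases)
    case 1
    then show ?thesis using img[OF i] by (auto simp: first_return_def)
  next
    case 2
    then have "\<theta> i \<in> {i, \<alpha> i}" using img[OF i] by blast
    then show ?thesis using 2 inj[of "\<alpha> i" i] by (auto simp: first_return_def)
  next
    case 3
    let ?j = "\<alpha> i" and ?k = "\<alpha> (\<alpha> i)"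
    note ne = 3(1,2,3) 3(1,2,3)[symmetric]
    have mem: "\<theta> x \<in> {i, ?j, ?k}" if "x \<in> {i, ?j, ?k}" for x
      using img[OF i] that unfolding 3(5) by blast
    have G: "card {x \<in> cyc i. \<theta> x \<noteq> x} + card {x \<in> cyc i. \<theta> x \<noteq> \<alpha> x} + 1
      = card (cyc i) + of_bool (card {x \<in> cyc i. \<theta> x \<noteq> x} > 0) + of_bool (card {x \<in> cyc i. \<theta> x \<noteq> \<alpha> x} > 0)"
      using genus_restrict_cyc_iff[OF permutes_inj[OF \<theta>] img[OF i] refl refl] gen[OF i] by blast
    \<comment> \<open>The inverse 3-cycle moves all three points and differs from
      \<open>\<alpha>\<close> at all three, so the criterion would read
      \<open>7 = 5\<close>.\<close>
    have "\<not> (\<theta> i = ?k \<and> \<theta> ?j = i \<and> \<theta> ?k = ?j)"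
      using G[unfolded card_filter[OF cyc_finite]] unfolding 3(5) by (auto simp: ne 3(4))
    then have bad: "\<not> (\<theta> i = ?k \<and> \<theta> ?j = i)"
      using mem[of ?k] inj[of i ?k] inj[of ?j ?k] ne by auto
    consider "\<theta> i = i" | "\<theta> i = ?j" | "\<theta> i = ?k" using mem[of i] by auto
    then show ?thesis
    proof cases
      case 2
      then have "\<theta> ?j \<noteq> ?j" using inj[of i ?j] ne by simp
      then show ?thesis using 2 ne by (simp add: first_return_def)
    next
      case 3
      then have "\<theta> ?j = ?j" "\<theta> ?k \<noteq> ?k"
        using mem[of ?j] inj[of i ?j] inj[of i ?k] ne bad by auto
      then show ?thesis using 3 ne by (simp add: first_return_def)
    qed (simp add: first_return_def)
  qed
  moreover have "\<theta> i = first_return \<alpha> ?P i" if "i \<notin> N" for i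
    using permutes_not_in[OF \<theta> that] by (simp add: first_return_def)
  ultimately show "\<theta> = first_return \<alpha> ?P" by blast
qed

lemma card_spanning_hypertrees:
  "card {\<theta>. spanning_hypertree n \<sigma> \<alpha> \<theta>} = card {P. good P \<and> tree_set P}"
proof -
  have iff: "spanning_hypertree n \<sigma> \<alpha> (first_return \<alpha> P) \<longleftrightarrow> tree_set P" if "good P" for P
  proof -
    have "comps N (gr \<sigma> \<union> gr (first_return \<alpha> P)) = comps N (gr \<sigma> \<union> cycle_links \<alpha> P)"
      by (rule comps_cong[OF conn_first_return[OF that]])
    then show ?thesis
      using num_cycles_first_return[OF that] refinement_first_return[OF that]
      unfolding spanning_hypertree_iff[OF n \<sigma>] tree_set_def by auto
  qed
  have supp: "{i. first_return \<alpha> P i \<noteq> i} = P" if "good P" for P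
    using first_return_moves[OF that] by blast
  have "bij_betw (first_return \<alpha>) {P. good P \<and> tree_set P} {\<theta>. spanning_hypertree n \<sigma> \<alpha> \<theta>}"
  proof (rule bij_betwI[where g = "\<lambda>\<theta>. {i. \<theta> i \<noteq> i}"])
    have r: "refinement n \<alpha> \<theta>" if "spanning_hypertree n \<sigma> \<alpha> \<theta>" for \<theta>
      using that by (simp add: spanning_hypertree_def)
    show "(\<lambda>\<theta>. {i. \<theta> i \<noteq> i}) \<in> {\<theta>. spanning_hypertree n \<sigma> \<alpha> \<theta>} \<rightarrow> {P. good P \<and> tree_set P}"
    proof (intro funcsetI CollectI)
      fix \<theta> assume "\<theta> \<in> {\<theta>. spanning_hypertree n \<sigma> \<alpha> \<theta>}"
      then have s: "spanning_hypertree n \<sigma> \<alpha> \<theta>" by simp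
      note R = refinement_support[OF r[OF s]]
      have "tree_set {i. \<theta> i \<noteq> i}" using iff[OF R(1)] s R(2) by simp
      then show "good {i. \<theta> i \<noteq> i} \<and> tree_set {i. \<theta> i \<noteq> i}" using R(1) by blast
    qed
    show "first_return \<alpha> {i. \<theta> i \<noteq> i} = \<theta>" if "\<theta> \<in> {\<theta>. spanning_hypertree n \<sigma> \<alpha> \<theta>}" for \<theta>
      using refinement_support(2)[OF r] that by simp
  qed (use iff supp in auto)
  then show ?thesis by (simp add: bij_betw_same_card)
qed

end

section \<open>The two-colored graph\<close>

lemma orbit_2cycle: "p x = y \<Longrightarrow> p y = x \<Longrightarrow> Orbits.orbit p x = {x, y}"
proof (intro subset_antisym subsetI)
  fix z assume *: "p x = y" "p y = x"
  show "z \<in> {x, y}" if "z \<in> Orbits.orbit p x" using that by induction (use * in auto)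
  show "z \<in> Orbits.orbit p x" if "z \<in> {x, y}"
    using that * Orbits.orbit.base[of p x] Orbits.orbit.step[of y p x] by auto
qed

lemma conn_neighbour:
  assumes "(u, v) \<in> conn r" "u \<noteq> v"
  obtains w where "(u, w) \<in> r \<or> (w, u) \<in> r"
  using assms unfolding conn_def by (auto elim: converse_rtranclE)

context short_pair
begin

abbreviation "three \<equiv> three_points n \<alpha>"
abbreviation "two \<equiv> {i \<in> N. card (cyc i) = 2}"
abbreviation "cycles3 \<equiv> cyc ` three"
abbreviation "cycles2 \<equiv> cyc ` two"
abbreviation "G \<equiv> tc_graph n \<sigma> \<alpha>"
abbreviation black :: "nat \<Rightarrow> (nat + nat) set" where "black i \<equiv> Inl ` Orbits.orbit \<sigma> i"
abbreviation white :: "nat set \<Rightarrow> (nat + nat) set" where "white c \<equiv> Inr ` c"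
abbreviation spoke :: "nat \<Rightarrow> (nat + nat) set" where "spoke i \<equiv> {Inl i, Inr i}"

text \<open>Spokes correspond to single points, but the edge of a 2-cycle of \<open>\<alpha>\<close>
  uses two black points. Meeting the 2-cycle is enough here, because admissible sets contain it
  entirely or not at all.\<close>

definition edge_set :: "nat set \<Rightarrow> (nat + nat) set set" where
  "edge_set Q = spoke ` (Q \<inter> three) \<union> (`) Inl ` {c \<in> cycles2. c \<inter> Q \<noteq> {}}"

definition endpoints :: "(nat + nat) set set \<Rightarrow> nat set" where
  "endpoints T = {i. Inl i \<in> \<Union>T}"

text \<open>Describes the sets of black points that come from edge sets: fixed points of
  \<open>\<alpha>\<close> carry no edge, and the edge of a 2-cycle brings both of its
  points.\<close>

definition admissible :: "nat set \<Rightarrow> bool" where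
  "admissible Q \<longleftrightarrow> Q \<subseteq> three \<union> two \<and> (\<forall>i\<in>Q. card (cyc i) = 2 \<longrightarrow> cyc i \<subseteq> Q)"

definition missed :: "nat set \<Rightarrow> nat set set" where
  "missed Q = {c \<in> cycles3. c \<inter> Q = {}}"

section \<open>Vertices and edges of the two-colored graph\<close>

lemma three_iff: "i \<in> three \<longleftrightarrow> i \<in> N \<and> card (cyc i) = 3"
  by (simp add: three_points_def)

lemma cyc_three: "i \<in> three \<Longrightarrow> j \<in> cyc i \<Longrightarrow> j \<in> three"
  using cyc_subset cyc_eq_iff[of i j] unfolding three_iff by fastforce

lemma cyc_two: "i \<in> two \<Longrightarrow> j \<in> cyc i \<Longrightarrow> j \<in> two"
  using cyc_subset cyc_eq_iff[of i j] by fastforce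

lemma finite_three: "finite three"
  by (rule finite_subset[of _ N]) (auto simp: three_points_def)

lemma orbit_S_Inl: "Orbits.orbit (tc_S n \<sigma> \<alpha>) (Inl i) = black i"
  by (rule orbit_inverse[symmetric])
    (use \<sigma> in \<open>auto simp: tc_S_def permutation_self_in_orbit permutation_of_permutes\<close>)

lemma orbit_S_Inr:
  assumes "i \<in> three"
  shows "Orbits.orbit (tc_S n \<sigma> \<alpha>) (Inr i) = white (cyc i)"
proof -
  have "Inr ` Orbits.orbit (inv' \<alpha>) i = Orbits.orbit (tc_S n \<sigma> \<alpha>) (Inr i)"
    by (rule orbit_inverse)
      (use assms cyc_three self_cyc in \<open>auto simp: tc_S_def orbit_inv_eq[OF perm]\<close>)
  then show ?thesis by (simp add: orbit_inv_eq[OF perm])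
qed

lemma ends_spoke: "i \<in> three \<Longrightarrow> ends G (spoke i) = {black i, white (cyc i)}"
  by (simp add: tc_graph_def orbit_S_Inl orbit_S_Inr)

lemma ends_Inl: "ends G (Inl ` c) = black ` c"
  by (simp add: tc_graph_def orbit_S_Inl image_image)

lemma verts_eq: "verts G = black ` N \<union> white ` cycles3"
  by (simp add: tc_graph_def perm_cycles_def tc_points_def image_Un image_image orbit_S_Inl orbit_S_Inr)

lemma white_verts_eq: "white_verts n \<sigma> \<alpha> = white ` cycles3"
  by (simp add: white_verts_def perm_cycles_def image_image orbit_S_Inr)

lemma edges_eq: "edges G = spoke ` three \<union> (`) Inl ` cycles2"
proof -
  let ?o = "Orbits.orbit (tc_A n \<alpha>)"
  have Inl3: "?o (Inl i) = spoke i" and Inr3: "?o (Inr i) = spoke i" if "i \<in> three" for i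
    using that orbit_2cycle[of "tc_A n \<alpha>" "Inl i" "Inr i"] orbit_2cycle[of "tc_A n \<alpha>" "Inr i" "Inl i"]
    by (auto simp: tc_A_def)
  have Inl: "?o (Inl i) = Inl ` cyc i" if "i \<in> N - three" for i
  proof (rule orbit_inverse[symmetric])
    fix x assume "x \<in> cyc i"
    then have "x \<notin> three" using that cyc_three[of x i] cyc_eq_iff[of i x] self_cyc[of i] by auto
    then show "tc_A n \<alpha> (Inl x) = Inl (\<alpha> x)" by (simp add: tc_A_def)
  qed (rule self_cyc)
  have "?o ` tc_points n \<alpha> = spoke ` three \<union> (\<lambda>i. Inl ` cyc i) ` (N - three)"
  proof -
    have "N = three \<union> (N - three)" using three_iff by blast
    then have "tc_points n \<alpha> = Inl ` three \<union> Inl ` (N - three) \<union> Inr ` three"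
      unfolding tc_points_def by (metis image_Un)
    moreover have "?o ` Inl ` three = spoke ` three" "?o ` Inr ` three = spoke ` three"
      "?o ` Inl ` (N - three) = (\<lambda>i. Inl ` cyc i) ` (N - three)"
      unfolding image_image using Inl3 Inr3 Inl by (auto intro!: image_cong)
    ultimately show ?thesis by (simp add: image_Un Un_ac)
  qed
  moreover have "edges G = {c \<in> ?o ` tc_points n \<alpha>. card c = 2}"
    by (simp add: tc_graph_def perm_cycles_def)
  moreover have "card (Inl ` cyc i :: (nat + nat) set) = card (cyc i)" for i
    by (simp add: card_image)
  moreover have "card (spoke i) = 2" for i by simp
  moreover have "i \<in> N - three" if "i \<in> two" for i using that three_iff by auto
  ultimately show ?thesis by (auto simp: image_iff)
qed

lemma edge_set_subset: "edge_set Q \<subseteq> edges G"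
  by (auto simp: edge_set_def edges_eq)

lemma admissible_subset: "admissible Q \<Longrightarrow> Q \<subseteq> N"
  by (auto simp: admissible_def three_points_def)

lemma admissible_cyc: "admissible Q \<Longrightarrow> i \<in> Q \<Longrightarrow> card (cyc i) = 2 \<Longrightarrow> cyc i \<subseteq> Q"
  by (simp add: admissible_def)

section \<open>Edge sets encoded as admissible sets of points\<close>

lemma endpoints_edge_set:
  assumes "admissible Q" shows "endpoints (edge_set Q) = Q"
proof (intro subset_antisym subsetI)
  fix i assume "i \<in> endpoints (edge_set Q)"
  then consider "i \<in> Q" | c where "c \<in> cycles2" "c \<inter> Q \<noteq> {}" "i \<in> c"
    by (auto simp: endpoints_def edge_set_def)
  then show "i \<in> Q"
  proof cases
    case 2
    then obtain j where j: "j \<in> Q" "j \<in> c" by blast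
    have "c = cyc j" using 2(1) j(2) cyc_eq_iff by auto
    moreover have "card c = 2" using 2(1) by auto
    ultimately have "c = cyc j" "card (cyc j) = 2" by simp_all
    then show ?thesis using assms j(1) 2(3) by (auto simp: admissible_def)
  qed
next
  fix i assume "i \<in> Q"
  then show "i \<in> endpoints (edge_set Q)"
    using assms self_cyc[of i] by (fastforce simp: endpoints_def edge_set_def admissible_def)
qed

lemma edge_set_endpoints:
  assumes "T \<subseteq> edges G"
  shows "admissible (endpoints T)" "edge_set (endpoints T) = T"
proof -
  let ?Q = "endpoints T"
  have T: "e \<in> spoke ` three \<or> e \<in> (`) Inl ` cycles2" if "e \<in> T" for e
    using that assms edges_eq by blast
  have Q: "(i \<in> three \<and> spoke i \<in> T) \<or> (i \<in> two \<and> Inl ` cyc i \<in> T)" if "i \<in> ?Q" for i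
  proof -
    from that obtain e where e: "e \<in> T" "Inl i \<in> e" by (auto simp: endpoints_def)
    from T[OF e(1)] show ?thesis
    proof
      assume "e \<in> (`) Inl ` cycles2"
      then obtain j where j: "j \<in> two" "e = Inl ` cyc j" by blast
      then have "i \<in> cyc j" using e(2) by auto
      then show ?thesis using j e cyc_two[of j i] cyc_eq_iff[of j i] by auto
    qed (use e in auto)
  qed
  show "admissible ?Q"
    unfolding admissible_def
  proof (intro conjI ballI impI)
    show "?Q \<subseteq> three \<union> two" using Q by blast
    fix i assume "i \<in> ?Q" "card (cyc i) = 2"
    then have "Inl ` cyc i \<in> T" using Q three_iff by fastforce
    then show "cyc i \<subseteq> ?Q" by (auto simp: endpoints_def)
  qed
  show "edge_set ?Q = T"
  proof (intro subset_antisym subsetI)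
    fix e assume "e \<in> edge_set ?Q"
    then consider i where "i \<in> ?Q" "i \<in> three" "e = spoke i"
      | j i where "j \<in> two" "i \<in> cyc j" "i \<in> ?Q" "e = Inl ` cyc j"
      by (auto simp: edge_set_def)
    then show "e \<in> T"
    proof cases
      case 1
      then show ?thesis using Q[of i] three_iff by auto
    next
      case 2
      then have "cyc i = cyc j" "i \<in> two" using cyc_eq_iff cyc_two by blast+
      then show ?thesis using 2 Q[of i] three_iff by auto
    qed
  next
    fix e assume e: "e \<in> T"
    from T[OF e] show "e \<in> edge_set ?Q"
    proof
      assume "e \<in> spoke ` three"
      then obtain i where i: "i \<in> three" "e = spoke i" by blast
      then have "i \<in> ?Q" using e by (auto simp: endpoints_def)
      then show ?thesis unfolding edge_set_def using i by blast
    next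
      assume "e \<in> (`) Inl ` cycles2"
      then obtain j where j: "j \<in> two" "e = Inl ` cyc j" by blast
      then have "j \<in> ?Q" using e self_cyc[of j] by (auto simp: endpoints_def)
      then have "cyc j \<inter> ?Q \<noteq> {}" using self_cyc by blast
      then show ?thesis unfolding edge_set_def using j by blast
    qed
  qed
qed

section \<open>Counting vertices and edges\<close>

lemma black_neq_white: "black i \<noteq> white c"
  using orbit_nonempty[of \<sigma> i] by blast

lemma black_in_verts: "i \<in> N \<Longrightarrow> black i \<in> verts G - white ` D"
  using black_neq_white[of i] by (auto simp: verts_eq)

lemma white_eq_iff: "white c = white d \<longleftrightarrow> c = d"
  by (simp add: inj_image_eq_iff)

lemma card_verts_diff:
  assumes "D \<subseteq> cycles3"
  shows "card (verts G - white ` D) + card D = num_cycles \<sigma> N + card cycles3"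
proof -
  have "card (verts G) = num_cycles \<sigma> N + card cycles3"
  proof -
    have "card (black ` N) = num_cycles \<sigma> N"
    proof -
      have "black ` N = (`) Inl ` perm_cycles \<sigma> N" by (simp add: perm_cycles_def image_image)
      then show ?thesis
        unfolding num_cycles_def by (simp add: card_image inj_on_def inj_image_eq_iff)
    qed
    moreover have "card (white ` cycles3) = card cycles3"
      by (simp add: card_image inj_on_def white_eq_iff)
    moreover have "black ` N \<inter> white ` cycles3 = {}" using black_neq_white by blast
    ultimately show ?thesis
      unfolding verts_eq using finite_three by (simp add: card_Un_disjoint)
  qed
  moreover have "card (white ` D) = card D" by (simp add: card_image inj_on_def white_eq_iff)
  moreover have "white ` D \<subseteq> verts G" using assms verts_eq by blast
  moreover have "finite (verts G)" unfolding verts_eq using finite_three by simp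
  ultimately show ?thesis by (metis add.commute card_Diff_subset card_mono finite_subset le_add_diff_inverse)
qed

lemma finite_admissible: "admissible Q \<Longrightarrow> finite Q"
  using admissible_subset finite_subset by blast

text \<open>For admissible \<open>Q\<close> the set \<open>hit Q - cycles3\<close> consists of the
  hit 2-cycles. Each of them has two points in \<open>Q\<close> but only one edge, whence the first
  equation; both sides of the second count the hit 2-cycles and all 3-cycles.\<close>

lemma card_edge_set:
  assumes "admissible Q"
  shows "card (edge_set Q) + card (hit Q - cycles3) = card Q"
    and "card (hit Q - cycles3) + card cycles3 = card (hit Q) + card (missed Q)"
    and "finite (edge_set Q)"
proof -
  let ?C2 = "{c \<in> cycles2. c \<inter> Q \<noteq> {}}"
  have cards: "c \<in> cycles3 \<Longrightarrow> card c = 3" "c \<in> cycles2 \<Longrightarrow> card c = 2" for c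
    by (auto simp: three_points_def)
  have disj: "cycles3 \<inter> cycles2 = {}"
  proof (rule ccontr)
    assume "cycles3 \<inter> cycles2 \<noteq> {}"
    then obtain c where "c \<in> cycles3" "c \<in> cycles2" by blast
    then show False using cards[of c] by simp
  qed
  have hit: "hit Q = {c \<in> cycles3. c \<inter> Q \<noteq> {}} \<union> ?C2"
  proof (intro subset_antisym subsetI)
    fix c assume "c \<in> hit Q"
    then obtain i where "i \<in> c" "i \<in> Q" "c \<in> cycles" by (auto simp: hit_def)
    then show "c \<in> {c \<in> cycles3. c \<inter> Q \<noteq> {}} \<union> ?C2"
      using cycle_eq[of c i] assms by (auto simp: admissible_def)
  qed (auto simp: hit_def perm_cycles_def three_points_def)
  have C2: "hit Q - cycles3 = ?C2" unfolding hit using disj by blast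
  have fin: "finite ?C2" "finite Q" "finite cycles3" using finite_admissible[OF assms] finite_three by simp_all
  have "card (edge_set Q) = card (spoke ` (Q \<inter> three)) + card ((`) Inl ` ?C2 :: (nat + nat) set set)"
    unfolding edge_set_def using fin by (intro card_Un_disjoint) auto
  moreover have "card (spoke ` (Q \<inter> three)) = card (Q \<inter> three)"
    by (rule card_image) (auto simp: inj_on_def doubleton_eq_iff)
  moreover have "card ((`) Inl ` ?C2 :: (nat + nat) set set) = card ?C2"
    by (rule card_image) (auto simp: inj_on_def inj_image_eq_iff)
  moreover have "card (Q \<inter> two) = 2 * card ?C2"
  proof -
    have "Q \<inter> two = \<Union>?C2"
    proof (intro subset_antisym subsetI)
      fix i assume "i \<in> Q \<inter> two"
      then show "i \<in> \<Union>?C2" using self_cyc[of i] by blast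
    next
      fix i assume "i \<in> \<Union>?C2"
      then obtain j k where jk: "j \<in> two" "i \<in> cyc j" "k \<in> cyc j" "k \<in> Q" by blast
      have "cyc k = cyc j" using jk(3) cyc_eq_iff by blast
      moreover have "card (cyc j) = 2" using jk(1) by simp
      ultimately have "cyc j \<subseteq> Q" using admissible_cyc[OF assms jk(4)] by simp
      then show "i \<in> Q \<inter> two" using jk(2) cyc_two[OF jk(1,2)] by blast
    qed
    moreover have "card (\<Union>?C2) = (\<Sum>c\<in>?C2. card c)"
    proof (rule card_Union_disjoint)
      show "pairwise disjnt ?C2"
      proof (rule pairwiseI)
        fix c d assume "c \<in> ?C2" "d \<in> ?C2" "c \<noteq> d"
        moreover from this have "c \<in> cycles" "d \<in> cycles" by (auto simp: perm_cycles_def)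
        ultimately show "disjnt c d" using cycle_eq unfolding disjnt_iff by blast
      qed
    qed (use cyc_finite in auto)
    moreover have "(\<Sum>c\<in>?C2. card c) = (\<Sum>c\<in>?C2. 2)" by (rule sum.cong[OF refl]) (rule cards(2), blast)
    ultimately show ?thesis by simp
  qed
  moreover have "card Q = card (Q \<inter> three) + card (Q \<inter> two)"
  proof -
    have "Q = (Q \<inter> three) \<union> (Q \<inter> two)" using assms by (auto simp: admissible_def)
    then have "card Q = card ((Q \<inter> three) \<union> (Q \<inter> two))" by simp
    also have "\<dots> = card (Q \<inter> three) + card (Q \<inter> two)"
      by (rule card_Un_disjoint) (use fin in \<open>auto simp: three_points_def\<close>)
    finally show ?thesis .
  qed
  ultimately show "card (edge_set Q) + card (hit Q - cycles3) = card Q" unfolding C2 by simp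
  have "card (hit Q) = card {c \<in> cycles3. c \<inter> Q \<noteq> {}} + card ?C2"
    unfolding hit
  proof (rule card_Un_disjoint)
    show "{c \<in> cycles3. c \<inter> Q \<noteq> {}} \<inter> ?C2 = {}" using disj by blast
  qed (use fin in simp_all)
  moreover have "card cycles3 = card {c \<in> cycles3. c \<inter> Q \<noteq> {}} + card (missed Q)"
  proof -
    have "cycles3 = {c \<in> cycles3. c \<inter> Q \<noteq> {}} \<union> missed Q" by (auto simp: missed_def)
    then have "card cycles3 = card ({c \<in> cycles3. c \<inter> Q \<noteq> {}} \<union> missed Q)" by simp
    also have "\<dots> = card {c \<in> cycles3. c \<inter> Q \<noteq> {}} + card (missed Q)"
      by (rule card_Un_disjoint) (use fin in \<open>auto simp: missed_def\<close>)
    finally show ?thesis .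
  qed
  ultimately show "card (hit Q - cycles3) + card cycles3 = card (hit Q) + card (missed Q)"
    unfolding C2 by simp
  show "finite (edge_set Q)" unfolding edge_set_def using fin by simp
qed

abbreviation deleted :: "nat set set \<Rightarrow> ((nat + nat) set, (nat + nat) set) multigraph" where
  "deleted D \<equiv> induced G (verts G - white ` D)"

text \<open>Deleting white vertices destroys precisely the spokes ending there, so no recorded edge
  is lost iff \<open>Q\<close> avoids the deleted 3-cycles.\<close>

lemma edge_set_subset_deleted:
  assumes "admissible Q" "D \<subseteq> cycles3"
  shows "edge_set Q \<subseteq> edges (deleted D) \<longleftrightarrow> D \<subseteq> missed Q"
proof
  assume sub: "edge_set Q \<subseteq> edges (deleted D)"
  show "D \<subseteq> missed Q"
  proof
    fix c assume c: "c \<in> D"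
    have "i \<notin> Q" if i: "i \<in> c" for i
    proof
      assume "i \<in> Q"
      have "c = cyc i" "i \<in> three" using c assms(2) i cyc_eq_iff cyc_three by blast+
      then have "spoke i \<in> edges (deleted D)" using sub \<open>i \<in> Q\<close> by (auto simp: edge_set_def)
      then have "white c \<notin> white ` D"
        using ends_spoke[OF \<open>i \<in> three\<close>] \<open>c = cyc i\<close> by (auto simp: induced_def)
      then show False using c by blast
    qed
    then show "c \<in> missed Q" using c assms(2) by (auto simp: missed_def)
  qed
next
  assume D: "D \<subseteq> missed Q"
  show "edge_set Q \<subseteq> edges (deleted D)"
  proof
    fix e assume e: "e \<in> edge_set Q"
    then consider i where "i \<in> Q" "i \<in> three" "e = spoke i" | c where "c \<in> cycles2" "e = Inl ` c"
      by (auto simp: edge_set_def)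
    then have "ends G e \<subseteq> verts G - white ` D"
    proof cases
      case 1
      then have "cyc i \<notin> D" using D self_cyc by (auto simp: missed_def)
      then have "white (cyc i) \<notin> white ` D" by (auto simp: white_eq_iff)
      moreover have "white (cyc i) \<in> verts G" unfolding verts_eq using 1(2) by simp
      moreover have "i \<in> N" using 1(2) three_iff by simp
      ultimately show ?thesis
        unfolding 1(3) ends_spoke[OF 1(2)] using black_in_verts[of i D] by simp
    next
      case 2
      then have "c \<subseteq> N" using cyc_subset by auto
      then have "black ` c \<subseteq> verts G - white ` D" by (intro image_subsetI black_in_verts) (rule subsetD)
      then show ?thesis unfolding 2(2) ends_Inl .
    qed
    then show "e \<in> edges (deleted D)" using e edge_set_subset by (auto simp: induced_def)
  qed
qed

section \<open>The recorded edges as a spanning subgraph after deletion of white vertices\<close>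

context
  fixes Q D F
  assumes Q: "admissible Q" and D: "D \<subseteq> missed Q"
  defines "F \<equiv> (deleted D)\<lparr>edges := edge_set Q\<rparr>"
begin

lemma D_subset: "D \<subseteq> cycles3"
  using D by (auto simp: missed_def)

lemma F_simps: "verts F = verts G - white ` D" "edges F = edge_set Q" "ends F = ends G"
  by (simp_all add: F_def induced_def)

lemma F_edge_cases:
  assumes "e \<in> edge_set Q"
  obtains i where "i \<in> Q" "i \<in> three" "ends F e = {black i, white (cyc i)}"
  | k where "cyc k \<subseteq> Q" "cyc k = {k, \<alpha> k}" "ends F e = {black k, black (\<alpha> k)}"
proof -
  from assms consider i where "i \<in> Q" "i \<in> three" "e = spoke i"
    | k where "k \<in> two" "cyc k \<inter> Q \<noteq> {}" "e = Inl ` cyc k"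
    by (auto simp: edge_set_def)
  then show ?thesis
  proof cases
    case 1
    then show ?thesis using that(1) ends_spoke by (simp add: F_simps)
  next
    case 2
    then obtain j where j: "j \<in> Q" "j \<in> cyc k" by blast
    have "cyc j = cyc k" using j(2) cyc_eq_iff by blast
    moreover have "card (cyc k) = 2" using 2(1) by simp
    ultimately have "cyc j = cyc k" "card (cyc k) = 2" by simp_all
    then have sub: "cyc k \<subseteq> Q" using admissible_cyc[OF Q j(1)] by simp
    have eq: "cyc k = {k, \<alpha> k}" using \<open>card (cyc k) = 2\<close> by (cases k rule: cyc_cases) auto
    have "ends F e = black ` cyc k" unfolding 2(3) F_simps ends_Inl ..
    then show ?thesis using that(2)[OF sub eq] unfolding eq by simp
  qed
qed

lemma F_ends: "\<forall>e\<in>edges F. \<exists>u\<in>verts F. \<exists>v\<in>verts F. ends F e = {u, v}"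
proof
  fix e assume e: "e \<in> edges F"
  then have "e \<in> edges (deleted D)"
    using edge_set_subset_deleted[OF Q D_subset] D by (auto simp: F_simps)
  then have sub: "ends F e \<subseteq> verts F" by (simp add: induced_def F_simps)
  from e have "e \<in> edge_set Q" by (simp add: F_simps)
  then show "\<exists>u\<in>verts F. \<exists>v\<in>verts F. ends F e = {u, v}"
    by (cases rule: F_edge_cases) (use sub in auto)
qed

lemma finite_verts_F: "finite (verts F)"
  using finite_three by (simp add: F_simps verts_eq)

lemma tree_F_iff:
  "mg_tree F \<longleftrightarrow> mg_connected F \<and> card (edge_set Q) + 1 = card (verts G - white ` D)"
  using mg_tree_iff[OF finite_verts_F _ F_ends] card_edge_set(3)[OF Q] by (simp add: F_simps)

text \<open>A white vertex that is kept although \<open>Q\<close> misses it is isolated, and a black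
  vertex always exists, so the graph would be disconnected.\<close>

lemma connected_F_missed:
  assumes "mg_connected F" shows "D = missed Q"
proof (rule ccontr)
  assume "D \<noteq> missed Q"
  then obtain c where c: "c \<in> cycles3" "c \<inter> Q = {}" "c \<notin> D" using D by (auto simp: missed_def)
  then have "white c \<in> verts F" by (auto simp: F_simps verts_eq white_eq_iff)
  moreover have "black 1 \<in> verts F" using n black_in_verts[of 1 D] by (simp add: F_simps)
  ultimately have "(white c, black 1) \<in> conn (adjacency F)"
    using assms unfolding mg_connected_iff comps_1_iff by blast
  then obtain w where "(white c, w) \<in> adjacency F \<or> (w, white c) \<in> adjacency F"
    using black_neq_white[of 1 c] by (metis conn_neighbour)
  then obtain e where e: "e \<in> edge_set Q" "white c \<in> ends F e" by (auto simp: adjacency_def F_simps)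
  from e(1) show False
  proof (cases rule: F_edge_cases)
    case (1 i)
    then have "c = cyc i" using e(2) black_neq_white[of i c] by (auto simp: white_eq_iff)
    then show False using 1 c(2) self_cyc by blast
  next
    case (2 k)
    then show False using e(2) black_neq_white[of k c] black_neq_white[of "\<alpha> k" c] by auto
  qed
qed

lemma adjacency_spoke:
  assumes "i \<in> Q" "i \<in> three" shows "(black i, white (cyc i)) \<in> adjacency F"
proof -
  have "spoke i \<in> edges F" using assms by (simp add: F_simps edge_set_def)
  moreover have "ends F (spoke i) = {black i, white (cyc i)}"
    using ends_spoke[OF assms(2)] by (simp add: F_simps)
  ultimately show ?thesis unfolding adjacency_def by blast
qed

text \<open>A step of \<open>\<sigma>\<close> stays within one black vertex. A link within a 3-cycle
  passes through its white vertex, and a link within a 2-cycle is an edge or trivial.\<close>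

lemma black_conn:
  assumes "(i, j) \<in> conn (gr \<sigma> \<union> cycle_links \<alpha> Q)"
  shows "(black i, black j) \<in> conn (adjacency F)"
proof -
  let ?C = "conn (adjacency F)"
  have spoke: "(black i, white (cyc i)) \<in> ?C" if "i \<in> Q" "i \<in> three" for i
    using adjacency_spoke[OF that] by (rule conn_incl)
  have link: "(black i, black j) \<in> ?C" if ij: "i \<in> Q" "j \<in> Q" "j \<in> cyc i" for i j
  proof (cases "i \<in> three")
    case True
    then have "j \<in> three" "cyc i = cyc j" using ij cyc_three cyc_eq_iff by blast+
    then show ?thesis using spoke[of i] spoke[of j] ij True by (metis conn_sym conn_trans)
  next
    case False
    then have i: "i \<in> two" using Q ij by (auto simp: admissible_def)
    show ?thesis
    proof (cases "j = i")
      case False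
      then have "cyc i = {i, j}" using i ij(3) self_cyc[of i]
        by (intro card_seteq[symmetric]) (auto intro: cyc_finite)
      then have "ends F (Inl ` cyc i) = {black i, black j}" unfolding F_simps ends_Inl by simp
      moreover have "Inl ` cyc i \<in> edges F"
        using i ij self_cyc[of i] by (auto simp: F_simps edge_set_def)
      ultimately show ?thesis by (intro conn_incl) (auto simp: adjacency_def)
    qed simp
  qed
  have adj: "(black y, black z) \<in> ?C" if "(y, z) \<in> gr \<sigma> \<union> cycle_links \<alpha> Q" for y z
  proof -
    from that consider "z = \<sigma> y" | "y \<in> Q" "z \<in> Q" "z \<in> cyc y" by (auto simp: cycle_links_def)
    then show ?thesis
    proof cases
      case 1
      then have "black z = black y"
        using permutation_orbit_step[OF permutation_of_permutes[OF \<sigma>], of y] by simp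
      then show ?thesis by simp
    qed (rule link)
  qed
  from assms show ?thesis
  proof (induction rule: conn_induct)
    case (step y z)
    then have "(black y, black z) \<in> ?C"
      using adj[of y z] conn_sym[OF adj[of z y]] by argo
    then show ?case using step.IH by (rule conn_trans[rotated])
  qed simp
qed

lemma conn_black:
  assumes "(black i, black j) \<in> conn (adjacency F)" "i \<in> N" "j \<in> N"
  shows "(i, j) \<in> conn (gr \<sigma> \<union> cycle_links \<alpha> Q)"
proof -
  let ?R = "gr \<sigma> \<union> cycle_links \<alpha> Q"
  \<comment> \<open>The points that a vertex stands for. At a white vertex only points of
    \<open>Q\<close> count, since the other spokes are absent from \<open>F\<close>.\<close>
  define pts where "pts v = {k. Inl k \<in> v} \<union> {k \<in> Q. Inr k \<in> v}" for v :: "(nat + nat) set"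
  have perm\<sigma>: "permutation \<sigma>" using \<sigma> by (simp add: permutation_of_permutes)
  have inside: "(k, l) \<in> conn ?R" if "v \<in> verts F" "k \<in> pts v" "l \<in> pts v" for v k l
  proof -
    from that(1) consider m where "v = black m" | c where "c \<in> cycles3" "v = white c"
      by (auto simp: F_simps verts_eq)
    then show ?thesis
    proof cases
      case 1
      then have "k \<in> Orbits.orbit \<sigma> m" "l \<in> Orbits.orbit \<sigma> m" using that by (auto simp: pts_def)
      then have "l \<in> Orbits.orbit \<sigma> k" using orbit_eq_iff[OF perm\<sigma>] by metis
      then have "(k, l) \<in> conn (gr \<sigma>)" by (simp add: in_conn_gr[OF perm\<sigma>])
      then show ?thesis using conn_mono[of "gr \<sigma>" ?R] by blast
    next
      case 2
      then have "k \<in> Q" "l \<in> Q" "k \<in> c" "l \<in> c" using that by (auto simp: pts_def)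
      moreover from this have "l \<in> cyc k" using 2(1) cyc_eq_iff by blast
      ultimately show ?thesis by (intro conn_incl) (simp add: cycle_links_def)
    qed
  qed
  have self: "k \<in> pts (black k)" for k
    using permutation_self_in_orbit[OF perm\<sigma>, of k] by (auto simp: pts_def)
  have adj: "\<exists>k\<in>pts u. \<exists>l\<in>pts v. (k, l) \<in> conn ?R" if "(u, v) \<in> adjacency F" for u v
  proof -
    have ex: "\<exists>k\<in>pts u. \<exists>l\<in>pts v. (k, l) \<in> conn ?R"
      if "k \<in> pts u" "l \<in> pts v" "(k, l) \<in> conn ?R" for k l
      using that by blast
    from that obtain e where e: "e \<in> edge_set Q" "ends F e = {u, v}"
      by (auto simp: adjacency_def F_simps)
    from e(1) show ?thesis
    proof (cases rule: F_edge_cases)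
      case (1 k)
      then have "k \<in> pts (white (cyc k))" using self_cyc by (auto simp: pts_def)
      moreover have "{u, v} = {black k, white (cyc k)}" using 1 e(2) by simp
      ultimately have k: "k \<in> pts u" "k \<in> pts v" using self[of k] by (auto simp: doubleton_eq_iff)
      show ?thesis by (rule ex[OF k conn_refl])
    next
      case (2 k)
      then have "u = black k \<and> v = black (\<alpha> k) \<or> u = black (\<alpha> k) \<and> v = black k"
        using e(2) unfolding doubleton_eq_iff[symmetric] by argo
      moreover have R: "(k, \<alpha> k) \<in> conn ?R"
        using 2 by (intro conn_incl) (auto simp: cycle_links_def)
      ultimately show ?thesis
      proof (elim disjE conjE)
        assume "u = black k" "v = black (\<alpha> k)"
        then show ?thesis using ex[OF _ _ R] self by blast
      next
        assume "u = black (\<alpha> k)" "v = black k"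
        then show ?thesis using ex[OF _ _ conn_sym[OF R]] self by blast
      qed
    qed
  qed
  have verts: "v \<in> verts F" if "(u, v) \<in> adjacency F \<or> (v, u) \<in> adjacency F" for u v
  proof -
    from that obtain e where "e \<in> edges F" "v \<in> ends F e" by (auto simp: adjacency_def)
    moreover obtain x y where "x \<in> verts F" "y \<in> verts F" "ends F e = {x, y}"
      using F_ends calculation(1) by blast
    ultimately show ?thesis by auto
  qed
  \<comment> \<open>The invariant ranges over all points of the vertex: an edge leaves through some
    point of \<open>y\<close> and arrives at some point of \<open>z\<close>, and
    \<open>inside\<close> spreads the connection to the other points of \<open>z\<close>.\<close>
  have "(black i, v) \<in> conn (adjacency F) \<Longrightarrow> \<forall>l\<in>pts v. (i, l) \<in> conn ?R" for v
  proof (induction rule: conn_induct)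
    case refl
    have "black i \<in> verts F" using black_in_verts[OF assms(2)] unfolding F_simps .
    then show ?case using inside self by blast
  next
    case (step y z)
    from step(2) have "(y, z) \<in> adjacency F" using adjacency_sym[of F] by blast
    then obtain k l where "k \<in> pts y" "l \<in> pts z" "(k, l) \<in> conn ?R"
      using adj by blast
    moreover have "(i, k) \<in> conn ?R" using step.IH calculation(1) by blast
    ultimately have "(i, l) \<in> conn ?R" by (meson conn_trans)
    then show ?case using inside[OF verts[OF step(2)] \<open>l \<in> pts z\<close>] conn_trans by fast
  qed
  then show ?thesis using assms(1) self by blast
qed

lemma connected_F_iff:
  assumes "D = missed Q"
  shows "mg_connected F \<longleftrightarrow> comps N (gr \<sigma> \<union> cycle_links \<alpha> Q) = 1"
proof
  assume L: "mg_connected F"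
  have "black i \<in> verts F" if "i \<in> N" for i
    using black_in_verts[OF that] unfolding F_simps .
  then have "(i, j) \<in> conn (gr \<sigma> \<union> cycle_links \<alpha> Q)" if "i \<in> N" "j \<in> N" for i j
    using L that conn_black unfolding mg_connected_iff comps_1_iff by blast
  moreover have "N \<noteq> {}" using n by simp
  ultimately show "comps N (gr \<sigma> \<union> cycle_links \<alpha> Q) = 1" unfolding comps_1_iff by blast
next
  assume R: "comps N (gr \<sigma> \<union> cycle_links \<alpha> Q) = 1"
  \<comment> \<open>With exactly the missed white vertices deleted, each remaining one has a spoke
    to a black vertex, so only black vertices have to be compared.\<close>
  have "\<exists>i\<in>N. (v, black i) \<in> conn (adjacency F)" if "v \<in> verts F" for v
  proof -
    from that consider i where "i \<in> N" "v = black i" | c where "c \<in> cycles3" "c \<notin> D" "v = white c"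
      by (auto simp: F_simps verts_eq)
    then show ?thesis
    proof cases
      case 2
      then obtain i where i: "i \<in> c" "i \<in> Q" using assms by (auto simp: missed_def)
      then have "i \<in> three" "c = cyc i" using 2(1) cyc_three cyc_eq_iff by blast+
      then have "(black i, v) \<in> conn (adjacency F)"
        using adjacency_spoke[OF i(2)] 2(3) by (simp add: conn_incl)
      moreover have "i \<in> N" using \<open>i \<in> three\<close> three_iff by simp
      ultimately show ?thesis using conn_sym[of "black i" v "adjacency F"] by blast
    next
      case 1
      then show ?thesis by (intro bexI[of _ i]) simp_all
    qed
  qed
  moreover have "(black i, black j) \<in> conn (adjacency F)" if "i \<in> N" "j \<in> N" for i j
    using R that black_conn unfolding comps_1_iff by blast
  ultimately have "(u, v) \<in> conn (adjacency F)" if "u \<in> verts F" "v \<in> verts F" for u v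
    using that conn_sym conn_trans by meson
  moreover have "black 1 \<in> verts F" using n black_in_verts[of 1 D] by (simp add: F_simps)
  ultimately show "mg_connected F" unfolding mg_connected_iff comps_1_iff by blast
qed

text \<open>In the comparison of edges with vertices, the vertices lost by deletion cancel against
  the 3-cycles that \<open>Q\<close> does not hit, which leaves the cardinality condition of
  \<open>tree_set\<close>.\<close>

lemma tree_F_iff_tree_set: "mg_tree F \<longleftrightarrow> tree_set Q \<and> D = missed Q"
proof (cases "D = missed Q")
  case True
  have "card (edge_set Q) + 1 = card (verts G - white ` D) \<longleftrightarrow>
      card Q + 1 = num_cycles \<sigma> N + card (hit Q)"
    using card_edge_set(1,2)[OF Q] card_verts_diff[OF D_subset] arg_cong[OF True, of card]
    by (intro iffI; linarith)
  then show ?thesis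
    unfolding tree_F_iff connected_F_iff[OF True] tree_set_def using True by simp
next
  case False
  then show ?thesis using connected_F_missed by (auto simp: mg_tree_def)
qed

end

lemma num_spanning_trees_deleted:
  assumes "D \<subseteq> cycles3"
  shows "num_spanning_trees (deleted D) = card {Q. admissible Q \<and> tree_set Q \<and> missed Q = D}"
proof -
  let ?T = "{T. T \<subseteq> edges (deleted D) \<and> mg_tree ((deleted D)\<lparr>edges := T\<rparr>)}"
  have iff: "edge_set Q \<in> ?T \<longleftrightarrow> tree_set Q \<and> missed Q = D" if "admissible Q" for Q
    using edge_set_subset_deleted[OF that assms] tree_F_iff_tree_set[OF that, of D] by auto
  have "bij_betw edge_set {Q. admissible Q \<and> tree_set Q \<and> missed Q = D} ?T"
  proof (rule bij_betwI[where g = endpoints])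
    have T: "T \<subseteq> edges G" if "T \<in> ?T" for T using that by (auto simp: induced_def)
    show "edge_set (endpoints T) = T" if "T \<in> ?T" for T
      by (rule edge_set_endpoints(2)[OF T[OF that]])
    show "endpoints \<in> ?T \<rightarrow> {Q. admissible Q \<and> tree_set Q \<and> missed Q = D}"
    proof
      fix T assume *: "T \<in> ?T"
      note E = edge_set_endpoints[OF T[OF *]]
      have "edge_set (endpoints T) \<in> ?T" unfolding E(2) by (rule *)
      then show "endpoints T \<in> {Q. admissible Q \<and> tree_set Q \<and> missed Q = D}"
        using iff[OF E(1)] E(1) by simp
    qed
  qed (use iff endpoints_edge_set in simp_all)
  then show ?thesis unfolding num_spanning_trees_def by (simp add: bij_betw_same_card)
qed

end

section \<open>Summation\<close>

text \<open>For each set of \<open>\<D>\<close> the choices are: empty, with weight \<open>-2\<close>, or one of three points,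
  with weight 1.\<close>

lemma sum_transversals:
  assumes "finite \<D>" "\<And>c. c \<in> \<D> \<Longrightarrow> card c = 3" "pairwise disjnt \<D>"
  shows "(\<Sum>U | U \<subseteq> \<Union>\<D> \<and> (\<forall>c\<in>\<D>. card (U \<inter> c) \<le> 1). (-2) ^ card {c \<in> \<D>. U \<inter> c = {}}) = (1 :: int)"
  using assms
proof (induction \<D>)
  case empty
  have "{U. U \<subseteq> \<Union>{} \<and> (\<forall>c\<in>{}. card (U \<inter> c) \<le> 1)} = {{}}" by auto
  then show ?case by simp
next
  case (insert c \<D>)
  define \<U> where "\<U> = {U. U \<subseteq> \<Union>\<D> \<and> (\<forall>c\<in>\<D>. card (U \<inter> c) \<le> 1)}"
  define w :: "'a set set \<Rightarrow> 'a set \<Rightarrow> int" where "w \<D> U = (-2) ^ card {c \<in> \<D>. U \<inter> c = {}}" for \<D> U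
  have IH: "(\<Sum>U\<in>\<U>. w \<D> U) = 1" using insert by (simp add: \<U>_def w_def pairwise_insert)
  have c: "card c = 3" "finite c" using insert.prems(1)[of c] by (simp_all add: card_ge_0_finite)
  have fin: "finite (\<Union>\<D>)" 
  proof (rule finite_Union[OF insert.hyps(1)])
    fix d assume "d \<in> \<D>"
    then have "card d = 3" using insert.prems(1) by blast
    then show "finite d" by (simp add: card_ge_0_finite)
  qed
  then have fin\<U>: "finite \<U>" by (simp add: \<U>_def)
  have disj: "d \<inter> c = {}" if "d \<in> \<D>" for d
    using insert.prems(2) insert.hyps(2) that by (auto simp: pairwise_insert disjnt_def)
  have disjU: "U \<inter> c = {}" if "U \<in> \<U>" for U
    using that disj unfolding \<U>_def by blast
  \<comment> \<open>A set either avoids the new 3-cycle \<open>c\<close> or has a unique point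
    \<open>x\<close> in it; in the second case \<open>x\<close> and the rest determine the set,
    since the rest is disjoint from \<open>c\<close>.\<close>
  have split: "{U. U \<subseteq> \<Union>(insert c \<D>) \<and> (\<forall>d\<in>insert c \<D>. card (U \<inter> d) \<le> 1)}
      = \<U> \<union> (\<lambda>(x, U). insert x U) ` (c \<times> \<U>)" (is "?L = ?R")
  proof (intro subset_antisym subsetI)
    fix U assume U: "U \<in> ?L"
    have "U - c \<in> \<U>"
    proof -
      have "(U - c) \<inter> d = U \<inter> d" if "d \<in> \<D>" for d using disj[OF that] by blast
      then show ?thesis using U by (auto simp: \<U>_def)
    qed
    have "card (U \<inter> c) \<le> 1" using U by simp
    then consider "U \<inter> c = {}" | x where "U \<inter> c = {x}"
      using c(2) by (metis One_nat_def card_1_singletonE card_0_eq finite_Int le_Suc_eq le_zero_eq)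
    then show "U \<in> ?R"
    proof cases
      case 1
      then have "U - c = U" by blast
      then show ?thesis using \<open>U - c \<in> \<U>\<close> by simp
    next
      case (2 x)
      then have "U = insert x (U - c)" "x \<in> c" by blast+
      then show ?thesis using \<open>U - c \<in> \<U>\<close> by (metis (no_types, lifting) SigmaI UnI2 case_prod_conv image_eqI)
    qed
  next
    fix U assume "U \<in> ?R"
    then consider "U \<in> \<U>" | x V where "x \<in> c" "V \<in> \<U>" "U = insert x V" by auto
    then show "U \<in> ?L"
    proof cases
      case 1
      then show ?thesis using disjU[OF 1] by (auto simp: \<U>_def)
    next
      case 2
      have V: "V \<subseteq> \<Union>\<D>" "\<And>d. d \<in> \<D> \<Longrightarrow> card (V \<inter> d) \<le> 1" using 2(2) by (auto simp: \<U>_def)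
      have "U \<inter> d = V \<inter> d" if "d \<in> \<D>" for d using disj[OF that] 2 by blast
      then have "\<forall>d\<in>\<D>. card (U \<inter> d) \<le> 1" using V(2) by simp
      moreover have "U \<inter> c = {x}" using disjU[OF 2(2)] 2 by blast
      then have "card (U \<inter> c) \<le> 1" by simp
      moreover have "U \<subseteq> \<Union>(insert c \<D>)" using V(1) 2 by blast
      ultimately show ?thesis by blast
    qed
  qed
  have inj: "inj_on (\<lambda>(x, U). insert x U) (c \<times> \<U>)"
  proof (rule inj_onI, clarify)
    fix x U y V assume *: "x \<in> c" "U \<in> \<U>" "y \<in> c" "V \<in> \<U>" "insert x U = insert y V"
    then have "insert x U \<inter> c = {x}" "insert y V \<inter> c = {y}" using disjU by blast+
    then have "x = y" using * by auto
    moreover have "x \<notin> U" "y \<notin> V" using * disjU by blast+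
    ultimately show "x = y \<and> U = V" using * by (metis insert_ident)
  qed
  have w1: "w (insert c \<D>) U = -2 * w \<D> U" if "U \<in> \<U>" for U
  proof -
    have "{d \<in> insert c \<D>. U \<inter> d = {}} = insert c {d \<in> \<D>. U \<inter> d = {}}" using disjU[OF that] by blast
    then show ?thesis using insert.hyps by (simp add: w_def)
  qed
  have w2: "w (insert c \<D>) (insert x U) = w \<D> U" if "U \<in> \<U>" "x \<in> c" for U x
  proof -
    have "{d \<in> insert c \<D>. insert x U \<inter> d = {}} = {d \<in> \<D>. U \<inter> d = {}}" using that disj by blast
    then show ?thesis by (simp add: w_def)
  qed
  have "(\<Sum>U\<in>?R. w (insert c \<D>) U) =
      (\<Sum>U\<in>\<U>. w (insert c \<D>) U) + (\<Sum>U\<in>(\<lambda>(x, U). insert x U) ` (c \<times> \<U>). w (insert c \<D>) U)"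
    using fin\<U> c(2) disjU by (intro sum.union_disjoint) auto
  also have "(\<Sum>U\<in>\<U>. w (insert c \<D>) U) = -2"
    using w1 IH by (simp add: sum_distrib_left[symmetric] del: mult_minus_left)
  also have "(\<Sum>U\<in>(\<lambda>(x, U). insert x U) ` (c \<times> \<U>). w (insert c \<D>) U) = (\<Sum>(x, U)\<in>c \<times> \<U>. w \<D> U)"
    using w2 by (subst sum.reindex[OF inj]) (auto intro!: sum.cong)
  also have "\<dots> = 3" using IH c(1) by (simp add: sum.cartesian_product[symmetric])
  finally show ?case unfolding split[symmetric] by (simp add: w_def)
qed

section \<open>Removing lonely points and regrouping the sum\<close>

context short_pair
begin

definition core :: "nat set \<Rightarrow> nat set" where
  "core Q = {i \<in> Q. \<exists>j\<in>Q. j \<noteq> i \<and> j \<in> cyc i}"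

lemma core_subset: "core Q \<subseteq> Q"
  by (auto simp: core_def)

lemma core_alone: "i \<in> Q \<Longrightarrow> i \<notin> core Q \<Longrightarrow> j \<in> Q \<Longrightarrow> j \<in> cyc i \<Longrightarrow> j = i"
  by (auto simp: core_def)

lemma cyc_sym: "j \<in> cyc i \<Longrightarrow> i \<in> cyc j"
  using cyc_eq_iff[of i j] self_cyc[of i] by auto

lemma good_core:
  assumes "Q \<subseteq> N" shows "good (core Q)"
  unfolding good_def
proof (intro conjI ballI)
  show "core Q \<subseteq> N" using assms core_subset by blast
  fix i assume "i \<in> core Q"
  then obtain j where j: "i \<in> Q" "j \<in> Q" "j \<noteq> i" "j \<in> cyc i" by (auto simp: core_def)
  then have "j \<in> core Q" using cyc_sym[OF j(4)] by (auto simp: core_def intro!: bexI[of _ i])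
  then show "\<exists>j\<in>core Q. j \<noteq> i \<and> j \<in> cyc i" using j by blast
qed

text \<open>A lonely point contributes only a loop to the links, and one to both sides of the
  cardinality condition: itself and the cycle that it alone hits.\<close>

lemma tree_set_core:
  assumes "Q \<subseteq> N" shows "tree_set (core Q) \<longleftrightarrow> tree_set Q"
proof -
  have fin: "finite Q" using assms finite_subset by blast
  have finC: "finite cycles" by (simp add: perm_cycles_def)
  have "conn (gr \<sigma> \<union> cycle_links \<alpha> (core Q)) = conn (gr \<sigma> \<union> cycle_links \<alpha> Q)"
  proof (intro conn_eqI subrelI)
    fix i j assume "(i, j) \<in> gr \<sigma> \<union> cycle_links \<alpha> (core Q)"
    then show "(i, j) \<in> conn (gr \<sigma> \<union> cycle_links \<alpha> Q)"
      using core_subset[of Q] by (intro conn_incl) (auto simp: cycle_links_def)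
  next
    fix i j assume *: "(i, j) \<in> gr \<sigma> \<union> cycle_links \<alpha> Q"
    show "(i, j) \<in> conn (gr \<sigma> \<union> cycle_links \<alpha> (core Q))"
    proof (cases "i = j")
      case False
      then have "(i, j) \<in> gr \<sigma> \<union> cycle_links \<alpha> (core Q)"
        using * cyc_sym[of j i] by (auto simp: cycle_links_def core_def)
      then show ?thesis by (rule conn_incl)
    qed simp
  qed
  moreover have "card Q + card (hit (core Q)) = card (core Q) + card (hit Q)"
  proof -
    \<comment> \<open>Lonely points lie on distinct cycles, and these are the cycles no longer hit
      once they are removed.\<close>
    have "bij_betw cyc (Q - core Q) (hit Q - hit (core Q))"
      unfolding bij_betw_def
    proof
      show "inj_on cyc (Q - core Q)"
        using core_alone cyc_eq_iff by (intro inj_onI) (metis DiffD1 DiffD2)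
      show "cyc ` (Q - core Q) = hit Q - hit (core Q)"
      proof (intro subset_antisym subsetI)
        fix c assume "c \<in> cyc ` (Q - core Q)"
        then obtain i where i: "i \<in> Q" "i \<notin> core Q" "c = cyc i" by blast
        have "c \<in> hit Q" using i assms self_cyc[of i] by (auto simp: hit_def perm_cycles_def)
        moreover have "c \<inter> core Q = {}"
          using core_alone[OF i(1,2)] i(2,3) core_subset[of Q] by blast
        ultimately show "c \<in> hit Q - hit (core Q)" by (simp add: hit_def)
      next
        fix c assume c: "c \<in> hit Q - hit (core Q)"
        then obtain i where "i \<in> c" "i \<in> Q" "c \<in> cycles" by (auto simp: hit_def)
        moreover from this have "i \<notin> core Q" using c by (auto simp: hit_def)
        ultimately show "c \<in> cyc ` (Q - core Q)" using cycle_eq by blast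
      qed
    qed
    then have "card (Q - core Q) = card (hit Q - hit (core Q))" by (rule bij_betw_same_card)
    moreover have "card (Q - core Q) + card (core Q) = card Q"
      using fin core_subset[of Q] by (metis add.commute card_Diff_subset card_mono finite_subset le_add_diff_inverse)
    moreover have "card (hit Q - hit (core Q)) + card (hit (core Q)) = card (hit Q)"
    proof -
      have "hit (core Q) \<subseteq> hit Q" using core_subset[of Q] by (auto simp: hit_def)
      moreover have "finite (hit Q)" using finC by (simp add: hit_def)
      ultimately show ?thesis
        by (metis add.commute card_Diff_subset card_mono finite_subset le_add_diff_inverse)
    qed
    ultimately show ?thesis by linarith
  qed
  then have "card (core Q) + 1 = num_cycles \<sigma> N + card (hit (core Q)) \<longleftrightarrow>
      card Q + 1 = num_cycles \<sigma> N + card (hit Q)"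
    by (intro iffI; linarith)
  ultimately show ?thesis unfolding tree_set_def by (simp only: comps_def)
qed

text \<open>The admissible sets with core \<open>P\<close> arise by adding at most one point on each
  3-cycle missed by \<open>P\<close>. No lonely point lies on a 2-cycle, because admissible sets
  contain both points of a 2-cycle or none. The weights of these choices are those of
  \<open>sum_transversals\<close>.\<close>

lemma core_fibre:
  assumes P: "good P"
  shows "(\<Sum>Q | admissible Q \<and> core Q = P. (-2) ^ card (missed Q)) = (1 :: int)"
proof -
  let ?\<D> = "missed P"
  let ?\<U> = "{U. U \<subseteq> \<Union>?\<D> \<and> (\<forall>c\<in>?\<D>. card (U \<inter> c) \<le> 1)}"
  have PN: "P \<subseteq> N" using P by (simp add: good_def)
  have D3: "c \<in> cycles3" "c \<inter> P = {}" if "c \<in> ?\<D>" for c using that by (auto simp: missed_def)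
  have cycD: "c = cyc i" if "c \<in> ?\<D>" "i \<in> c" for c i using D3(1)[OF that(1)] that(2) cyc_eq_iff by auto
  have D: "finite ?\<D>" "\<And>c. c \<in> ?\<D> \<Longrightarrow> card c = 3" "pairwise disjnt ?\<D>"
  proof -
    show "finite ?\<D>" using finite_three by (simp add: missed_def)
    show "\<And>c. c \<in> ?\<D> \<Longrightarrow> card c = 3" by (auto simp: missed_def three_points_def)
    show "pairwise disjnt ?\<D>" unfolding pairwise_def disjnt_iff using cycD by metis
  qed
  have dP: "U \<inter> P = {}" if "U \<in> ?\<U>" for U using that D3(2) by blast
  have "bij_betw (\<lambda>U. P \<union> U) ?\<U> {Q. admissible Q \<and> core Q = P}"
  proof (rule bij_betwI[where g = "\<lambda>Q. Q - P"])
    show "(\<lambda>U. P \<union> U) \<in> ?\<U> \<rightarrow> {Q. admissible Q \<and> core Q = P}"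
    proof (intro funcsetI CollectI conjI)
      fix U assume U: "U \<in> ?\<U>"
      have U3: "U \<subseteq> three" using U D3(1) cyc_three by blast
      \<comment> \<open>On a 2-cycle the companion that goodness provides is the only other point,
        so the whole cycle lies in \<open>P\<close>.\<close>
      have P2: "i \<in> three \<or> i \<in> two \<and> cyc i \<subseteq> P" if i: "i \<in> P" for i
      proof -
        obtain j where "j \<in> P" "j \<noteq> i" "j \<in> cyc i" using P i by (auto simp: good_def)
        then show ?thesis using i PN by (cases i rule: cyc_cases) (auto simp: three_iff)
      qed
      show "admissible (P \<union> U)"
        unfolding admissible_def
      proof (intro conjI ballI impI)
        show "P \<union> U \<subseteq> three \<union> two" using U3 P2 by blast
        fix i assume i: "i \<in> P \<union> U" "card (cyc i) = 2"
        then have "i \<notin> three" by (simp add: three_points_def)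
        then show "cyc i \<subseteq> P \<union> U" using i(1) U3 P2 by blast
      qed
      \<comment> \<open>The cycle of \<open>i\<close> misses \<open>P\<close>, so a companion of
        \<open>i\<close> would be a second point of \<open>U\<close> on that cycle.\<close>
      have "i \<notin> core (P \<union> U)" if i: "i \<in> U" for i
      proof
        assume "i \<in> core (P \<union> U)"
        then obtain j where j: "j \<in> P \<union> U" "j \<noteq> i" "j \<in> cyc i" by (auto simp: core_def)
        obtain c where c: "c \<in> ?\<D>" "i \<in> c" using U i by blast
        then have "c = cyc i" by (rule cycD)
        then have "j \<in> U" using j D3(2)[OF c(1)] by blast
        then have "{i, j} \<subseteq> U \<inter> c" using i j c \<open>c = cyc i\<close> by blast
        then have "card {i, j} \<le> card (U \<inter> c)"
          using \<open>c = cyc i\<close> cyc_finite by (intro card_mono) auto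
        moreover have "card (U \<inter> c) \<le> 1" using U c by blast
        ultimately show False using j(2) by simp
      qed
      moreover have "P \<subseteq> core (P \<union> U)" using P unfolding good_def core_def by blast
      ultimately show "core (P \<union> U) = P" using core_subset[of "P \<union> U"] by blast
    qed
    show "(\<lambda>Q. Q - P) \<in> {Q. admissible Q \<and> core Q = P} \<rightarrow> ?\<U>"
    proof (intro funcsetI)
      fix Q assume "Q \<in> {Q. admissible Q \<and> core Q = P}"
      then have Q: "admissible Q" "core Q = P" by auto
      have alone: "j = i" if "i \<in> Q - P" "j \<in> Q" "j \<in> cyc i" for i j
        using core_alone[of i Q j] that Q(2) by blast
      have "i \<in> \<Union>?\<D>" if i: "i \<in> Q - P" for i
      proof -
        have "cyc i \<inter> P = {}" using alone[OF i] i core_subset[of Q] Q(2) by blast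
        moreover have "i \<in> three"
        proof (rule ccontr)
          assume "i \<notin> three"
          then have 2: "card (cyc i) = 2" using Q(1) i by (auto simp: admissible_def)
          then have "cyc i \<subseteq> Q" using admissible_cyc[OF Q(1)] i by blast
          then have "cyc i \<subseteq> {i}" using alone[OF i] by blast
          then have "card (cyc i) \<le> card {i}" by (intro card_mono) auto
          then show False using 2 by simp
        qed
        ultimately have "cyc i \<in> ?\<D>" by (simp add: missed_def)
        then show ?thesis using self_cyc by blast
      qed
      moreover have "card ((Q - P) \<inter> c) \<le> 1" if c: "c \<in> ?\<D>" for c
      proof (cases "(Q - P) \<inter> c = {}")
        case False
        then obtain i where i: "i \<in> Q - P" "i \<in> c" by blast
        then have "(Q - P) \<inter> c \<subseteq> {i}" using alone[OF i(1)] cycD[OF c i(2)] by blast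
        then have "card ((Q - P) \<inter> c) \<le> card {i}" by (intro card_mono) auto
        then show ?thesis by simp
      qed (simp only: card.empty zero_le)
      ultimately show "Q - P \<in> ?\<U>" by blast
    qed
    show "P \<union> U - P = U" if "U \<in> ?\<U>" for U using dP[OF that] by blast
    show "P \<union> (Q - P) = Q" if "Q \<in> {Q. admissible Q \<and> core Q = P}" for Q
      using that core_subset by blast
  qed
  then have "(\<Sum>Q | admissible Q \<and> core Q = P. (-2) ^ card (missed Q)) =
      (\<Sum>U\<in>?\<U>. (-2) ^ card (missed (P \<union> U)) :: int)"
    by (rule sum.reindex_bij_betw[symmetric])
  also have "\<dots> = (\<Sum>U\<in>?\<U>. (-2) ^ card {c \<in> ?\<D>. U \<inter> c = {}})"
  proof (rule sum.cong[OF refl])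
    fix U
    have "missed (P \<union> U) = {c \<in> ?\<D>. U \<inter> c = {}}" by (auto simp: missed_def)
    then show "(-2 :: int) ^ card (missed (P \<union> U)) = (-2) ^ card {c \<in> ?\<D>. U \<inter> c = {}}" by simp
  qed
  also have "\<dots> = 1" by (rule sum_transversals[OF D])
  finally show ?thesis .
qed

text \<open>One weighted sum over admissible tree sets is grouped in two ways: by the missed
  3-cycles, which gives the right-hand side, and by the core. Being a tree set depends on the core
  only, so each good tree set contributes a full fibre, of total weight 1.\<close>

lemma alternating_count:
  "int (card {P. good P \<and> tree_set P}) =
     (\<Sum>D\<in>Pow cycles3. (-2) ^ card D * int (card {Q. admissible Q \<and> tree_set Q \<and> missed Q = D}))"
proof -
  let ?\<Q> = "{Q. admissible Q \<and> tree_set Q}" and ?\<P> = "{P. good P \<and> tree_set P}"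
  let ?w = "\<lambda>Q. (-2) ^ card (missed Q) :: int"
  have "?\<Q> \<subseteq> Pow N" "?\<P> \<subseteq> Pow N" using admissible_subset by (auto simp: good_def)
  then have fin: "finite ?\<Q>" "finite ?\<P>" by (simp_all add: finite_subset)
  have "(\<Sum>D\<in>Pow cycles3. (-2) ^ card D * int (card {Q. admissible Q \<and> tree_set Q \<and> missed Q = D}))
      = (\<Sum>D\<in>Pow cycles3. \<Sum>Q\<in>{Q \<in> ?\<Q>. missed Q = D}. ?w Q)"
  proof (rule sum.cong[OF refl])
    fix D
    have "{Q. admissible Q \<and> tree_set Q \<and> missed Q = D} = {Q \<in> ?\<Q>. missed Q = D}" by blast
    moreover have "(\<Sum>Q\<in>{Q \<in> ?\<Q>. missed Q = D}. ?w Q) = (\<Sum>Q\<in>{Q \<in> ?\<Q>. missed Q = D}. (-2) ^ card D)"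
      by (rule sum.cong) auto
    ultimately show "(-2) ^ card D * int (card {Q. admissible Q \<and> tree_set Q \<and> missed Q = D})
        = (\<Sum>Q\<in>{Q \<in> ?\<Q>. missed Q = D}. ?w Q)" by simp
  qed
  also have "\<dots> = (\<Sum>Q\<in>?\<Q>. ?w Q)"
    by (rule sum.group[OF fin(1)]) (use finite_three in \<open>auto simp: missed_def\<close>)
  also have "\<dots> = (\<Sum>P\<in>?\<P>. \<Sum>Q\<in>{Q \<in> ?\<Q>. core Q = P}. ?w Q)"
    by (rule sum.group[symmetric, OF fin])
      (use admissible_subset good_core tree_set_core in auto)
  also have "\<dots> = (\<Sum>P\<in>?\<P>. 1)"
  proof (rule sum.cong[OF refl])
    fix P assume P: "P \<in> ?\<P>"
    then have "{Q \<in> ?\<Q>. core Q = P} = {Q. admissible Q \<and> core Q = P}"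
      using admissible_subset tree_set_core by blast
    then show "(\<Sum>Q\<in>{Q \<in> ?\<Q>. core Q = P}. ?w Q) = 1" using core_fibre P by simp
  qed
  finally show ?thesis by simp
qed

lemma count_spanning_hypertrees:
  "int (card {\<theta>. spanning_hypertree n \<sigma> \<alpha> \<theta>}) =
    (\<Sum>S\<in>Pow (white_verts n \<sigma> \<alpha>).
       (-2) ^ card S * int (num_spanning_trees (induced G (verts G - S))))"
proof -
  have inj: "inj_on white X" for X by (simp add: inj_on_def white_eq_iff)
  have "Pow (white_verts n \<sigma> \<alpha>) = (\<lambda>D. white ` D) ` Pow cycles3"
    unfolding white_verts_eq by (simp add: image_Pow_surj)
  moreover have "inj_on (\<lambda>D. white ` D) (Pow cycles3)"
    by (rule inj_on_image_Pow[OF inj])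
  ultimately have "(\<Sum>S\<in>Pow (white_verts n \<sigma> \<alpha>).
       (-2) ^ card S * int (num_spanning_trees (induced G (verts G - S)))) =
     (\<Sum>D\<in>Pow cycles3. (-2) ^ card (white ` D) * int (num_spanning_trees (deleted D)))"
    by (simp add: sum.reindex)
  also have "\<dots> = (\<Sum>D\<in>Pow cycles3. (-2) ^ card D * int (card {Q. admissible Q \<and> tree_set Q \<and> missed Q = D}))"
    by (rule sum.cong) (simp_all add: card_image[OF inj] num_spanning_trees_deleted)
  finally show ?thesis using alternating_count card_spanning_hypertrees by simp
qed

end

theorem theorem8p3:
  fixes n :: nat and \<sigma> \<alpha> :: "nat \<Rightarrow> nat"
  assumes "hypermap n \<sigma> \<alpha>"
    and "short_hyperedges n \<alpha>"
  shows "int (card {\<theta>. spanning_hypertree n \<sigma> \<alpha> \<theta>}) =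
    (\<Sum>S\<in>Pow (white_verts n \<sigma> \<alpha>).
       (-2) ^ card S *
       int (num_spanning_trees
              (induced (tc_graph n \<sigma> \<alpha>) (verts (tc_graph n \<sigma> \<alpha>) - S))))"
proof (cases "n = 0")
  case True
  \<comment> \<open>The empty hypermap has no face, hence no unicellular companion. The only summand
    belongs to the empty set and vanishes because the graph without vertices is not
    connected.\<close>
  have "{\<theta>. spanning_hypertree n \<sigma> \<alpha> \<theta>} = {}"
    using True by (simp add: spanning_hypertree_def unicellular_def num_cycles_def perm_cycles_def)
  moreover have "white_verts n \<sigma> \<alpha> = {}" "verts (tc_graph n \<sigma> \<alpha>) = {}"
    using True by (simp_all add: white_verts_def tc_graph_def tc_points_def three_points_def perm_cycles_def)
  moreover have "num_spanning_trees (induced (tc_graph n \<sigma> \<alpha>) {}) = 0"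
    by (simp add: num_spanning_trees_def mg_tree_def mg_connected_def induced_def)
  ultimately show ?thesis by simp
next
  case False
  then interpret short_pair n \<sigma> \<alpha>
    using assms by unfold_locales (simp_all add: hypermap_def)
  show ?thesis by (rule count_spanning_hypertrees)
qed

end
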